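(* Let $W=(W_{s,t},(s,t)\in[0,1]^2)$ be a $d$-dimensional Brownian sheet on a filtered probability space $(\Omega,\mathcal F,(\mathcal F_{s,t}),\mathbb P)$, vanishing on the axes, and let $b:[0,1]^2\times\mathbb R^d\to\mathbb R^d$ be Borel measurable, uniformly bounded, and componentwise nondecreasing in space. Then there exists $\Omega_1\subset\Omega$ with $\mathbb P(\Omega_1)=1$ such that for every $\omega\in\Omega_1$, the only continuous function $u:[0,1]^2\to\mathbb R^d$ vanishing on $\{0\}\times[0,1]\cup[0,1]\times\{0\}$ and satisfying $$u(s,t)=\int_0^t\int_0^s\{b(\xi,\zeta,W_{\xi,\zeta}(\omega)+u(\xi,\zeta))-b(\xi,\zeta,W_{\xi,\zeta}(\omega))\}\,d\xi\,d\zeta\quad\forall (s,t)\in[0,1]^2$$ is $u\equiv0$.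
   Context: Componentwise nondecreasing in space: for $x,y\in\mathbb R^d$ with $x_i\le y_i$ for all $i$, $b_i(s,t,x)\le b_i(s,t,y)$ for every component $i$ and every $(s,t)$. A $d$-dimensional Brownian sheet: $d$ independent real continuous adapted two-parameter processes whose rectangular increments over $]s,s']\times]t,t']$ are centered Gaussian with variance $(s'-s)(t'-t)$ and independent of $\mathcal F_{s,1}\vee\mathcal F_{1,t}$. *)

theory Defs
  imports "HOL-Probability.Probability"
begin

definition filtration2 :: "'a measure \<Rightarrow> (real \<Rightarrow> real \<Rightarrow> 'a measure) \<Rightarrow> bool" where
  "filtration2 M F \<longleftrightarrow>
     (\<forall>s\<in>{0..1}. \<forall>t\<in>{0..1}. space (F s t) = space M \<and> sets (F s t) \<subseteq> sets M) \<and>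
     (\<forall>s\<in>{0..1}. \<forall>s'\<in>{0..1}. \<forall>t\<in>{0..1}. \<forall>t'\<in>{0..1}.
        s \<le> s' \<longrightarrow> t \<le> t' \<longrightarrow> sets (F s t) \<subseteq> sets (F s' t'))"

definition rect_incr ::
  "(real \<Rightarrow> real \<Rightarrow> 'a \<Rightarrow> real) \<Rightarrow> real \<Rightarrow> real \<Rightarrow> real \<Rightarrow> real \<Rightarrow> 'a \<Rightarrow> real" where
  "rect_incr X s s' t t' \<omega> = X s' t' \<omega> - X s t' \<omega> - X s' t \<omega> + X s t \<omega>"

definition brownian_sheet ::
  "'a measure \<Rightarrow> (real \<Rightarrow> real \<Rightarrow> 'a measure) \<Rightarrow> (real \<Rightarrow> real \<Rightarrow> 'a \<Rightarrow> real^'d) \<Rightarrow> bool" where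
  "brownian_sheet M F W \<longleftrightarrow>
     prob_space M \<and> filtration2 M F \<and>
     \<comment> \<open>adapted\<close>
     (\<forall>i. \<forall>s\<in>{0..1}. \<forall>t\<in>{0..1}. (\<lambda>\<omega>. W s t \<omega> $ i) \<in> borel_measurable (F s t)) \<and>
     \<comment> \<open>continuous paths\<close>
     (\<forall>\<omega>\<in>space M. continuous_on ({0..1} \<times> {0..1}) (\<lambda>(s,t). W s t \<omega>)) \<and>
     \<comment> \<open>vanishing on the axes\<close>
     (\<forall>\<omega>\<in>space M. \<forall>r\<in>{0..1}. W 0 r \<omega> = 0 \<and> W r 0 \<omega> = 0) \<and>
     \<comment> \<open>the d component processes are independent\<close>
     prob_space.indep_vars M (\<lambda>i. Pi\<^sub>M ({0..1} \<times> {0..1}) (\<lambda>_. borel))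
        (\<lambda>i \<omega>. \<lambda>p\<in>{0..1} \<times> {0..1}. W (fst p) (snd p) \<omega> $ i) UNIV \<and>
     \<comment> \<open>Gaussian rectangular increments, independent of F(s,1) join F(1,t)\<close>
     (\<forall>i. \<forall>s s' t t'. 0 \<le> s \<longrightarrow> s < s' \<longrightarrow> s' \<le> 1 \<longrightarrow> 0 \<le> t \<longrightarrow> t < t' \<longrightarrow> t' \<le> 1 \<longrightarrow>
        distributed M lborel (rect_incr (\<lambda>a b \<omega>. W a b \<omega> $ i) s s' t t')
          (normal_density 0 (sqrt ((s' - s) * (t' - t)))) \<and>
        prob_space.indep_set M
          {(rect_incr (\<lambda>a b \<omega>. W a b \<omega> $ i) s s' t t') -` B \<inter> space M | B. B \<in> sets borel}
          (sigma_sets (space M) (sets (F s 1) \<union> sets (F 1 t))))"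

end

theory Submission
  imports Defs
begin

text \<open>
  Work on the grid of mesh \<open>1/n\<close>. By monotonicity of \<open>b\<close> and uniform continuity, for large \<open>n\<close>
  every solution \<open>u\<close> satisfies \<open>W + u \<le> X\<close> on the grid, where \<open>X\<close> is the explicit Euler scheme
  driven by the increments of \<open>W\<close> with drift \<open>b(X + \<epsilon>) - b(W - \<epsilon>)\<close> (\<open>b\<close> averaged over cells).
  Hence \<open>u \<le> 0\<close> follows once \<open>X - W\<close> is small in probability. The scheme is a triangular shift of
  a finite family of independent Gaussians, and with \<open>Z\<^sup>\<plusminus>\<close> the Girsanov densities of the drifts
  \<open>b(W \<plusminus> \<epsilon>)\<close> one has exactly \<open>E[f(X) Z\<^sup>-] = E[f(W) Z\<^sup>+]\<close>. For increasing \<open>f\<close> with values in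
  \<open>[0,1]\<close> this bounds \<open>E[(f(X) - f(W)) Z\<^sup>-]\<close> by \<open>E|Z\<^sup>+ - Z\<^sup>-|\<close>, which is controlled by
  the mean distance of the two drifts, and that is \<open>O(\<epsilon> + 1/n)\<close> because shifting a Gaussian of variance
  \<open>s t\<close> by \<open>2 \<epsilon>\<close> changes its law by at most a constant times \<open>\<epsilon> / sqrt (s t)\<close> in total variation.
  Fatou's lemma in \<open>n\<close> and then \<open>\<epsilon> \<rightarrow> 0\<close> give \<open>u \<le> 0\<close>; the reverse inequality is the same
  statement for \<open>-W\<close>, \<open>-u\<close> and \<open>-b(-x)\<close>.
\<close>

section \<open>Triangular shifts of Gaussian product measures\<close>

text \<open>The exceptional null set must serve all solutions at once, and a solution belonging to a
  single path need not be adapted to anything, so no change of measure can be carried out along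
  \<open>u\<close> itself. It is carried out along the scheme, a functional of \<open>W\<close>
  alone that dominates every \<open>W + u\<close> on fine grids. Only laws are compared there: the
  Girsanov identity relates expectations of \<open>X\<close> and of \<open>W\<close>, never the two
  at the same \<omega>. The pointwise order \<open>W \<le> X\<close>, a consequence of monotonicity,
  is what turns a comparison of expectations into a bound on \<open>f(X) - f(W)\<close>. The drift
  may be discontinuous; the two margins \<epsilon> absorb the oscillation of the paths inside a
  cell, and averaging over cells deals with \<open>(s, t)\<close>. How fine the grid has to be
  depends on the path and on \<open>u\<close>, hence a limit through a liminf that does not mention
  \<open>u\<close>. On a grid the planar Girsanov theorem is a finite triangular change of
  variables, so no stochastic integral occurs.\<close>

definition gauss :: "real \<Rightarrow> real measure" where
  "gauss v = density lborel (normal_density 0 (sqrt v))"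

lemma sets_gauss [measurable_cong, simp]: "sets (gauss v) = sets borel"
  by (simp add: gauss_def)

lemma space_gauss [simp]: "space (gauss v) = UNIV"
  by (simp add: gauss_def)

lemma prob_space_gauss: "v > 0 \<Longrightarrow> prob_space (gauss v)"
  unfolding gauss_def by (rule prob_space_normal_density) simp

text \<open>Cameron-Martin in one dimension: completing the square, the factor
  \<open>exp (p * z - v / 2 * p\<^sup>2)\<close> moves the mean of the centred Gaussian of variance
  \<open>v\<close> from 0 to \<open>v * p\<close>. For \<open>ennreal\<close>-valued
  \<open>g\<close> no integrability has to be checked.\<close>

lemma nn_integral_gauss_shift:
  fixes g :: "real \<Rightarrow> ennreal"
  assumes v: "v > 0" and [measurable]: "g \<in> borel_measurable borel"
  shows "(\<integral>\<^sup>+z. g z * ennreal (exp (p * z - v / 2 * p\<^sup>2)) \<partial>gauss v) = (\<integral>\<^sup>+z. g (z + v * p) \<partial>gauss v)"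
proof -
  let ?d = "normal_density 0 (sqrt v)"
  have tilt: "?d z * exp (p * z - v / 2 * p\<^sup>2) = ?d (z - v * p)" for z
  proof -
    have "- z\<^sup>2 / (2 * v) + (p * z - v / 2 * p\<^sup>2) = - (z - v * p)\<^sup>2 / (2 * v)"
      using v by (simp add: field_simps power2_eq_square)
    then show ?thesis using v
      by (simp add: normal_density_def mult_exp_exp)
  qed
  have "ennreal (?d z) * (g z * ennreal (exp (p * z - v / 2 * p\<^sup>2))) = ennreal (?d (z - v * p)) * g z" for z
    unfolding tilt[symmetric] by (subst ennreal_mult) (simp_all add: mult_ac)
  then have "(\<integral>\<^sup>+z. g z * ennreal (exp (p * z - v / 2 * p\<^sup>2)) \<partial>gauss v)
      = (\<integral>\<^sup>+z. ennreal (?d (z - v * p)) * g z \<partial>lborel)"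
    unfolding gauss_def
    by (subst nn_integral_density) auto
  also have "\<dots> = (\<integral>\<^sup>+z. ennreal (?d z) * g (z + v * p) \<partial>lborel)"
    using nn_integral_real_affine[of "\<lambda>z. ennreal (?d (z - v * p)) * g z" 1 "v * p"]
    by (simp add: add.commute)
  also have "\<dots> = (\<integral>\<^sup>+z. g (z + v * p) \<partial>gauss v)"
    unfolding gauss_def by (subst nn_integral_density) auto
  finally show ?thesis .
qed

text \<open>The coefficient \<open>p a\<close> depends only on coordinates in \<open>I\<close> of strictly smaller rank. Measurability is
  required on every \<open>S\<close> containing these coordinates, so that one coordinate can be peeled off at a time.\<close>

definition predictable :: "'i set \<Rightarrow> ('i \<Rightarrow> nat) \<Rightarrow> ('i \<Rightarrow> ('i \<Rightarrow> real) \<Rightarrow> real) \<Rightarrow> bool" where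
  "predictable I r p \<longleftrightarrow> (\<forall>a\<in>I.
     (\<forall>S. {c\<in>I. r c < r a} \<subseteq> S \<longrightarrow> S \<subseteq> I \<longrightarrow> p a \<in> borel_measurable (Pi\<^sub>M S (\<lambda>_. borel))) \<and>
     (\<forall>y y'. (\<forall>c\<in>I. r c < r a \<longrightarrow> y c = y' c) \<longrightarrow> p a y = p a y'))"

text \<open>The discrete Girsanov density (stochastic exponential): \<open>y a\<close> is an
  increment of variance \<open>v\<close> and \<open>p a\<close> its drift per unit of variance, so
  under this density the increment is displaced by \<open>v * p a\<close>.\<close>

definition dens :: "real \<Rightarrow> 'i set \<Rightarrow> ('i \<Rightarrow> ('i \<Rightarrow> real) \<Rightarrow> real) \<Rightarrow> ('i \<Rightarrow> real) \<Rightarrow> real" where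
  "dens v I p y = exp (\<Sum>a\<in>I. p a y * y a - v / 2 * (p a y)\<^sup>2)"

lemma predictable_measurable:
  "predictable I r p \<Longrightarrow> a \<in> I \<Longrightarrow> p a \<in> borel_measurable (Pi\<^sub>M I (\<lambda>_. borel))"
  unfolding predictable_def by blast

lemma dens_measurable:
  assumes "predictable I r p"
  shows "dens v I p \<in> borel_measurable (Pi\<^sub>M I (\<lambda>_. borel))"
proof -
  note [measurable] = predictable_measurable[OF assms]
  show ?thesis unfolding dens_def by measurable
qed

text \<open>As \<open>x\<close> has top rank, no coefficient at a point of \<open>S\<close> reads
  the coordinate \<open>x\<close>. Ties in rank are harmless, because coefficients depend on
  strictly lower ranks.\<close>

lemma predictable_insertD:
  assumes p: "predictable (insert x S) r p" and top: "\<And>c. c \<in> S \<Longrightarrow> r c \<le> r x"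
  shows "predictable S r p"
proof -
  have eq: "{c \<in> insert x S. r c < r a} = {c\<in>S. r c < r a}" if "a \<in> S" for a
    using top[OF that] by auto
  show ?thesis unfolding predictable_def
  proof (intro ballI conjI allI impI)
    fix a T assume "a \<in> S" "{c\<in>S. r c < r a} \<subseteq> T" "T \<subseteq> S"
    then have "a \<in> insert x S" "{c \<in> insert x S. r c < r a} \<subseteq> T" "T \<subseteq> insert x S"
      using eq[of a] by blast+
    then show "p a \<in> borel_measurable (Pi\<^sub>M T (\<lambda>_. borel))"
      using p unfolding predictable_def by blast
  next
    fix a and y y' :: "'a \<Rightarrow> real" assume a: "a \<in> S" and y: "\<forall>c\<in>S. r c < r a \<longrightarrow> y c = y' c"
    then have "\<forall>c\<in>insert x S. r c < r a \<longrightarrow> y c = y' c"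
      using eq[OF a] by blast
    then show "p a y = p a y'"
      using p a unfolding predictable_def by blast
  qed
qed

lemma predictable_cong:
  assumes "predictable I r p" "a \<in> I" "\<And>c. c \<in> I \<Longrightarrow> r c < r a \<Longrightarrow> y c = y' c"
  shows "p a y = p a y'"
  using assms unfolding predictable_def by blast

text \<open>Integrating out a coordinate of maximal rank first, both densities reduce to the same
  one-dimensional translation.\<close>

lemma gauss_triangular_shift:
  fixes r :: "'i \<Rightarrow> nat"
  assumes v: "v > 0" and "finite I" and "predictable I r p" "predictable I r q"
  shows "\<exists>\<Phi> \<in> Pi\<^sub>M I (\<lambda>_. borel) \<rightarrow>\<^sub>M Pi\<^sub>M I (\<lambda>_. borel).
     (\<forall>y\<in>space (Pi\<^sub>M I (\<lambda>_. borel)). \<forall>a\<in>I. \<Phi> y a = y a + v * (q a (\<Phi> y) - p a y)) \<and>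
     (\<forall>f\<in>borel_measurable (Pi\<^sub>M I (\<lambda>_. borel)).
       (\<integral>\<^sup>+y. f (\<Phi> y) * ennreal (dens v I p y) \<partial>Pi\<^sub>M I (\<lambda>_. gauss v))
       = (\<integral>\<^sup>+y. f y * ennreal (dens v I q y) \<partial>Pi\<^sub>M I (\<lambda>_. gauss v)))"
  using assms(2-4)
proof (induction rule: finite_ranking_induct[where f = r])
  case empty
  show ?case by (intro bexI[of _ "\<lambda>x. x"]) (auto simp: dens_def)
next
  case (insert x S)
  show ?case
  proof (cases "x \<in> S")
    case True
    then show ?thesis using insert by (simp add: insert_absorb)
  next
    case False
    interpret G: prob_space "gauss v" by (rule prob_space_gauss[OF v])
    interpret product_sigma_finite "\<lambda>_::'i. gauss v" by standard
    let ?P = "\<lambda>S::'i set. Pi\<^sub>M S (\<lambda>_. borel :: real measure)"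
    let ?G = "\<lambda>S::'i set. Pi\<^sub>M S (\<lambda>_. gauss v)"
    have setsG [measurable_cong]: "sets (?G T) = sets (?P T)" for T
      by (intro sets_PiM_cong) auto
    have spaceG [simp]: "space (?G T) = space (?P T)" for T
      by (simp add: space_PiM)
    note pS = predictable_insertD[OF insert.prems(1) insert.hyps(2)]
    note qS = predictable_insertD[OF insert.prems(2) insert.hyps(2)]
    from insert.IH[OF pS qS] obtain \<Phi>
      where [measurable]: "\<Phi> \<in> ?P S \<rightarrow>\<^sub>M ?P S"
        and \<Phi>: "\<And>y a. y \<in> space (?P S) \<Longrightarrow> a \<in> S \<Longrightarrow> \<Phi> y a = y a + v * (q a (\<Phi> y) - p a y)"
        and IH: "\<And>f. f \<in> borel_measurable (?P S) \<Longrightarrow>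
             (\<integral>\<^sup>+y. f (\<Phi> y) * ennreal (dens v S p y) \<partial>?G S) = (\<integral>\<^sup>+y. f y * ennreal (dens v S q y) \<partial>?G S)"
      by blast
    have below: "{c\<in>insert x S. r c < r x} \<subseteq> S" by auto
    have [measurable]: "p x \<in> borel_measurable (?P S)" "q x \<in> borel_measurable (?P S)"
      using insert.prems below unfolding predictable_def by blast+
    have [measurable]: "p x \<in> borel_measurable (?P (insert x S))" "q x \<in> borel_measurable (?P (insert x S))"
      using insert.prems by (auto intro: predictable_measurable)
    note [measurable] = dens_measurable[OF pS] dens_measurable[OF qS]
      dens_measurable[OF insert.prems(1)] dens_measurable[OF insert.prems(2)]
    \<comment> \<open>The old map acts on \<open>S\<close>; the top coordinate is displaced using
      \<open>p\<close> at the old point and \<open>q\<close> at the new one, both of which read only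
      coordinates in \<open>S\<close>.\<close>
    define \<Psi> where "\<Psi> y = (\<Phi> (restrict y S))(x := y x + v * (q x (\<Phi> (restrict y S)) - p x (restrict y S)))" for y
    have restr [measurable]: "(\<lambda>y. restrict y S) \<in> ?P (insert x S) \<rightarrow>\<^sub>M ?P S"
      by (rule measurable_restrict_subset) auto
    have comp: "(\<lambda>y. y x) \<in> borel_measurable (?P (insert x S))" by measurable
    note [measurable] = this
    have meas: "\<Psi> \<in> ?P (insert x S) \<rightarrow>\<^sub>M ?P (insert x S)"
      unfolding \<Psi>_def by measurable
    have upd_eq: "p a (w(x := z)) = p a w" "q a (w(x := z)) = q a w" if "a \<in> insert x S" for a w z
    proof -
      have "r a \<le> r x" using that insert.hyps(2) by auto
      then show "p a (w(x := z)) = p a w" "q a (w(x := z)) = q a w"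
        using that by (auto intro!: predictable_cong[OF insert.prems(1)] predictable_cong[OF insert.prems(2)])
    qed
    have restr_eq: "p a (restrict w S) = p a w" "q a (restrict w S) = q a w" if "a \<in> insert x S" for a w
    proof -
      have "r a \<le> r x" using that insert.hyps(2) by auto
      then show "p a (restrict w S) = p a w" "q a (restrict w S) = q a w"
        using that by (auto intro!: predictable_cong[OF insert.prems(1)] predictable_cong[OF insert.prems(2)])
    qed
    have step: "\<Psi> y a = y a + v * (q a (\<Psi> y) - p a y)" if y: "y \<in> space (?P (insert x S))" and a: "a \<in> insert x S" for y a
    proof (cases "a = x")
      case True
      then show ?thesis unfolding \<Psi>_def by (simp add: upd_eq restr_eq)
    next
      case ax: False
      then have "a \<in> S" using a by simp
      moreover have "restrict y S \<in> space (?P S)" by (simp add: space_PiM)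
      ultimately have "\<Phi> (restrict y S) a = y a + v * (q a (\<Phi> (restrict y S)) - p a (restrict y S))"
        using \<Phi> by simp
      then show ?thesis using ax a unfolding \<Psi>_def by (simp add: upd_eq restr_eq)
    qed
    have dens_upd: "dens v (insert x S) p' (w(x := z)) = dens v S p' w * exp (p' x w * z - v / 2 * (p' x w)\<^sup>2)"
      if "\<And>a. a \<in> insert x S \<Longrightarrow> p' a (w(x := z)) = p' a w" for p' w z
    proof -
      have "(\<Sum>a\<in>S. p' a (w(x := z)) * (w(x := z)) a - v / 2 * (p' a (w(x := z)))\<^sup>2)
          = (\<Sum>a\<in>S. p' a w * w a - v / 2 * (p' a w)\<^sup>2)"
        using False that by (intro sum.cong) auto
      then show ?thesis using False insert.hyps(1) that[of x]
        unfolding dens_def by (simp add: exp_add mult.commute)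
    qed
    have dens_p: "dens v (insert x S) p (w(x := z)) = dens v S p w * exp (p x w * z - v / 2 * (p x w)\<^sup>2)" for w z
      by (rule dens_upd) (rule upd_eq)
    have dens_q: "dens v (insert x S) q (w(x := z)) = dens v S q w * exp (q x w * z - v / 2 * (q x w)\<^sup>2)" for w z
      by (rule dens_upd) (rule upd_eq)
    have dens_nonneg: "dens v T p' w \<ge> 0" for T p' and w :: "'i \<Rightarrow> real"
      by (simp add: dens_def)
    have integ: "(\<integral>\<^sup>+y. f (\<Psi> y) * ennreal (dens v (insert x S) p y) \<partial>?G (insert x S))
        = (\<integral>\<^sup>+y. f y * ennreal (dens v (insert x S) q y) \<partial>?G (insert x S))"
      if f [measurable]: "f \<in> borel_measurable (?P (insert x S))" for f
    proof -
      note [measurable] = meas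
      \<comment> \<open>Integral over the top coordinate under the \<open>q\<close>-tilt. Both sides
        of the claim reduce to integrals over \<open>S\<close> of \<open>g\<close>, or of
        \<open>g\<close> after \<open>\<Phi>\<close>, where the induction hypothesis
        applies.\<close>
      define g where "g w = (\<integral>\<^sup>+z. f (w(x := z)) * ennreal (exp (q x w * z - v / 2 * (q x w)\<^sup>2)) \<partial>gauss v)" for w
      have [measurable]: "g \<in> borel_measurable (?P S)"
        unfolding g_def by measurable
      have g': "g w = (\<integral>\<^sup>+z. f (w(x := z + v * q x w)) \<partial>gauss v)" if w: "w \<in> space (?P S)" for w
        unfolding g_def
        by (rule nn_integral_gauss_shift[OF v]) (use w in measurable)
      have "(\<integral>\<^sup>+y. f (\<Psi> y) * ennreal (dens v (insert x S) p y) \<partial>?G (insert x S))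
        = (\<integral>\<^sup>+w. \<integral>\<^sup>+z. f (\<Psi> (w(x := z))) * ennreal (dens v (insert x S) p (w(x := z))) \<partial>gauss v \<partial>?G S)"
        using False insert.hyps(1) by (intro product_nn_integral_insert) measurable
      also have "\<dots> = (\<integral>\<^sup>+w. g (\<Phi> w) * ennreal (dens v S p w) \<partial>?G S)"
      proof (rule nn_integral_cong)
        fix w assume "w \<in> space (?G S)"
        then have w: "w \<in> space (?P S)" by simp
        then have rw: "restrict (w(x := z)) S = w" for z
          using False by (auto simp: space_PiM PiE_def extensional_def fun_eq_iff)
        have \<Phi>w: "\<Phi> w \<in> space (?P S)" using w by (rule measurable_space[rotated]) measurable
        have meas1: "(\<lambda>z. f ((\<Phi> w)(x := z + c))) \<in> borel_measurable borel" for c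
          using \<Phi>w by measurable
        have "(\<integral>\<^sup>+z. f (\<Psi> (w(x := z))) * ennreal (dens v (insert x S) p (w(x := z))) \<partial>gauss v)
          = (\<integral>\<^sup>+z. (f ((\<Phi> w)(x := z + v * (q x (\<Phi> w) - p x w))) * ennreal (exp (p x w * z - v / 2 * (p x w)\<^sup>2)))
               * ennreal (dens v S p w) \<partial>gauss v)"
          by (intro nn_integral_cong)
             (simp add: dens_p \<Psi>_def rw dens_nonneg ennreal_mult' mult_ac)
        also have "\<dots> = (\<integral>\<^sup>+z. f ((\<Phi> w)(x := z + v * (q x (\<Phi> w) - p x w))) * ennreal (exp (p x w * z - v / 2 * (p x w)\<^sup>2)) \<partial>gauss v)
               * ennreal (dens v S p w)"
          by (intro nn_integral_multc borel_measurable_times_ennreal)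
             (simp_all add: meas1 measurable_cong_sets[OF sets_gauss refl])
        \<comment> \<open>The tilt by \<open>p x w\<close> translates by \<open>v * p x w\<close>
          and cancels the \<open>p\<close>-part of the displacement; the translation
          \<open>v * q x (\<Phi> w)\<close> that remains is the one in
          \<open>g (\<Phi> w)\<close>.\<close>
        also have "\<dots> = (\<integral>\<^sup>+z. f ((\<Phi> w)(x := (z + v * p x w) + v * (q x (\<Phi> w) - p x w))) \<partial>gauss v) * ennreal (dens v S p w)"
          by (subst nn_integral_gauss_shift[OF v meas1]) simp
        also have "\<dots> = g (\<Phi> w) * ennreal (dens v S p w)"
          by (simp add: g'[OF \<Phi>w] algebra_simps)
        finally show "(\<integral>\<^sup>+z. f (\<Psi> (w(x := z))) * ennreal (dens v (insert x S) p (w(x := z))) \<partial>gauss v)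
          = g (\<Phi> w) * ennreal (dens v S p w)" .
      qed
      also have "\<dots> = (\<integral>\<^sup>+w. g w * ennreal (dens v S q w) \<partial>?G S)"
        by (rule IH) simp
      also have "\<dots> = (\<integral>\<^sup>+w. \<integral>\<^sup>+z. f (w(x := z)) * ennreal (dens v (insert x S) q (w(x := z))) \<partial>gauss v \<partial>?G S)"
      proof (rule nn_integral_cong)
        fix w assume "w \<in> space (?G S)"
        then have w: "w \<in> space (?P S)" by simp
        have meas2: "(\<lambda>z. f (w(x := z))) \<in> borel_measurable borel"
          using w by measurable
        have "g w * ennreal (dens v S q w) =
          (\<integral>\<^sup>+z. f (w(x := z)) * ennreal (exp (q x w * z - v / 2 * (q x w)\<^sup>2)) * ennreal (dens v S q w) \<partial>gauss v)"
          unfolding g_def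
          by (intro nn_integral_multc[symmetric] borel_measurable_times_ennreal)
             (simp_all add: meas2 measurable_cong_sets[OF sets_gauss refl])
        also have "\<dots> = (\<integral>\<^sup>+z. f (w(x := z)) * ennreal (dens v (insert x S) q (w(x := z))) \<partial>gauss v)"
          by (intro nn_integral_cong) (simp add: dens_q dens_nonneg ennreal_mult' mult_ac)
        finally
        show "g w * ennreal (dens v S q w) = (\<integral>\<^sup>+z. f (w(x := z)) * ennreal (dens v (insert x S) q (w(x := z))) \<partial>gauss v)" .
      qed
      also have "\<dots> = (\<integral>\<^sup>+y. f y * ennreal (dens v (insert x S) q y) \<partial>?G (insert x S))"
        using False insert.hyps(1) by (intro product_nn_integral_insert[symmetric]) measurable
      finally show ?thesis .
    qed
    show ?thesis
      using meas step integ by blast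
  qed
qed

lemma integral_Cauchy_Schwarz:
  fixes f g :: "'a \<Rightarrow> real"
  assumes [measurable]: "f \<in> borel_measurable M" "g \<in> borel_measurable M"
    and f2: "integrable M (\<lambda>x. (f x)\<^sup>2)" and g2: "integrable M (\<lambda>x. (g x)\<^sup>2)"
  shows "integrable M (\<lambda>x. f x * g x)"
    and "(\<integral>x. f x * g x \<partial>M)\<^sup>2 \<le> (\<integral>x. (f x)\<^sup>2 \<partial>M) * (\<integral>x. (g x)\<^sup>2 \<partial>M)"
proof -
  show fg: "integrable M (\<lambda>x. f x * g x)"
  proof (rule Bochner_Integration.integrable_bound)
    show "integrable M (\<lambda>x. (f x)\<^sup>2 + (g x)\<^sup>2)"
      using f2 g2 by simp
    have "\<bar>f x * g x\<bar> \<le> (f x)\<^sup>2 + (g x)\<^sup>2" for x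
    proof -
      have "2 * (\<bar>f x\<bar> * \<bar>g x\<bar>) \<le> (f x)\<^sup>2 + (g x)\<^sup>2" "0 \<le> \<bar>f x\<bar> * \<bar>g x\<bar>"
        using sum_squares_bound[of "\<bar>f x\<bar>" "\<bar>g x\<bar>"] by (simp_all add: mult.assoc)
      then show ?thesis unfolding abs_mult by linarith
    qed
    then show "AE x in M. norm (f x * g x) \<le> norm ((f x)\<^sup>2 + (g x)\<^sup>2)"
      by auto
  qed measurable
  let ?a = "\<integral>x. (f x)\<^sup>2 \<partial>M" and ?b = "\<integral>x. f x * g x \<partial>M" and ?c = "\<integral>x. (g x)\<^sup>2 \<partial>M"
  have quad: "0 \<le> ?a + 2 * t * ?b + t\<^sup>2 * ?c" for t
  proof -
    have "0 \<le> (\<integral>x. (f x + t * g x)\<^sup>2 \<partial>M)"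
      by (rule integral_nonneg_AE) auto
    also have "\<dots> = (\<integral>x. (f x)\<^sup>2 + (2 * t) * (f x * g x) + t\<^sup>2 * (g x)\<^sup>2 \<partial>M)"
      by (intro Bochner_Integration.integral_cong refl) (simp add: power2_eq_square algebra_simps)
    also have "\<dots> = ?a + 2 * t * ?b + t\<^sup>2 * ?c"
      using f2 g2 fg by simp
    finally show ?thesis .
  qed
  show "?b\<^sup>2 \<le> ?a * ?c"
  proof (cases "?c = 0")
    case True
    have "?b = 0"
    proof (rule ccontr)
      assume b: "?b \<noteq> 0"
      \<comment> \<open>With \<open>?c = 0\<close> the quadratic form is affine in \<open>t\<close>;
        at this value of \<open>t\<close> it would equal -1.\<close>
      have "2 * (- (?a + 1) / (2 * ?b)) * ?b = - (?a + 1)" using b by simp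
      with quad[of "- (?a + 1) / (2 * ?b)"] True show False by simp
    qed
    with True show ?thesis by simp
  next
    case False
    have c: "?c > 0" using False integral_nonneg_AE[of "\<lambda>x. (g x)\<^sup>2" M] by (simp add: less_le)
    have "0 \<le> (?a + 2 * (- ?b / ?c) * ?b + (- ?b / ?c)\<^sup>2 * ?c) * ?c"
      using quad[of "- ?b / ?c"] c by simp
    also have "\<dots> = ?a * ?c - ?b\<^sup>2"
      using c by (simp add: field_simps power2_eq_square)
    finally show ?thesis by simp
  qed
qed

text \<open>Used for \<open>2 * p\<close>, \<open>- p\<close> and the midpoint of \<open>p\<close>
  and \<open>q\<close>, the drifts that occur in powers and products of densities.\<close>

lemma predictable_compose2:
  fixes p q :: "'a \<Rightarrow> ('a \<Rightarrow> real) \<Rightarrow> real" and h :: "real \<Rightarrow> real \<Rightarrow> real"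
  assumes p: "predictable I r p" and q: "predictable I r q"
    and h: "(\<lambda>(x, y). h x y) \<in> borel_measurable (borel \<Otimes>\<^sub>M borel)"
  shows "predictable I r (\<lambda>a y. h (p a y) (q a y))"
proof -
  have "(\<lambda>y. h (p a y) (q a y)) \<in> borel_measurable (Pi\<^sub>M S (\<lambda>_. borel))"
    if [measurable]: "p a \<in> borel_measurable (Pi\<^sub>M S (\<lambda>_. borel))" "q a \<in> borel_measurable (Pi\<^sub>M S (\<lambda>_. borel))"
    for S a
    using measurable_compose[OF measurable_Pair[OF that] h] by simp
  note meas = this
  show ?thesis
    unfolding predictable_def
  proof (intro ballI conjI allI impI)
    fix a S assume "a \<in> I" "{c \<in> I. r c < r a} \<subseteq> S" "S \<subseteq> I"
    then show "(\<lambda>y. h (p a y) (q a y)) \<in> borel_measurable (Pi\<^sub>M S (\<lambda>_. borel))"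
      using p q unfolding predictable_def by (intro meas) blast+
  next
    fix a and y y' :: "'a \<Rightarrow> real"
    assume a: "a \<in> I" and "\<forall>c\<in>I. r c < r a \<longrightarrow> y c = y' c"
    then have "p a y = p a y'" "q a y = q a y'"
      by (auto intro: predictable_cong[OF p a] predictable_cong[OF q a])
    then show "h (p a y) (q a y) = h (p a y') (q a y')" by simp
  qed
qed

section \<open>Girsanov densities on a finite Gaussian product: moments and total variation\<close>

locale gauss_product =
  fixes v :: real and I :: "'i set" and r :: "'i \<Rightarrow> nat"
  assumes v: "v > 0" and fin: "finite I"
begin

abbreviation "P \<equiv> Pi\<^sub>M I (\<lambda>_. borel :: real measure)"
definition "G = Pi\<^sub>M I (\<lambda>_. gauss v)"

lemma sets_G [measurable_cong]: "sets G = sets P"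
  unfolding G_def by (intro sets_PiM_cong) auto

lemma space_G: "space G = space P"
  by (simp add: G_def space_PiM)

sublocale prob_space G
  unfolding G_def by (intro prob_space_PiM prob_space_gauss v)

abbreviation "\<rho> \<equiv> dens v I"

text \<open>A change of drift: \<open>\<Phi> y - v * q (\<Phi> y) = y - v * p y\<close>
  coordinatewise, so the noise left after removing the drift is the same, and the
  \<open>p\<close>-tilted law is carried to the \<open>q\<close>-tilted one.\<close>

definition drift_shift where
  "drift_shift p q \<Phi> \<longleftrightarrow> \<Phi> \<in> P \<rightarrow>\<^sub>M P \<and>
     (\<forall>y\<in>space P. \<forall>a\<in>I. \<Phi> y a = y a + v * (q a (\<Phi> y) - p a y)) \<and>
     (\<forall>f\<in>borel_measurable P.
       (\<integral>\<^sup>+y. f (\<Phi> y) * ennreal (\<rho> p y) \<partial>G) = (\<integral>\<^sup>+y. f y * ennreal (\<rho> q y) \<partial>G))"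

lemma drift_shift_ex:
  assumes "predictable I r p" "predictable I r q"
  shows "\<exists>\<Phi>. drift_shift p q \<Phi>"
  using gauss_triangular_shift[OF v fin assms, folded G_def] unfolding drift_shift_def Bex_def .

lemma
  assumes "drift_shift p q \<Phi>"
  shows drift_shift_measurable: "\<Phi> \<in> P \<rightarrow>\<^sub>M P"
    and drift_shift_apply: "y \<in> space P \<Longrightarrow> a \<in> I \<Longrightarrow> \<Phi> y a = y a + v * (q a (\<Phi> y) - p a y)"
    and drift_shift_nn_integral: "f \<in> borel_measurable P \<Longrightarrow>
       (\<integral>\<^sup>+y. f (\<Phi> y) * ennreal (\<rho> p y) \<partial>G) = (\<integral>\<^sup>+y. f y * ennreal (\<rho> q y) \<partial>G)"
  using assms unfolding drift_shift_def by auto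

lemma predictable_const: "predictable I r (\<lambda>a _. c a)"
  by (simp add: predictable_def)

lemma dens_pos: "\<rho> p y > 0"
  by (simp add: dens_def)

lemma dens_nonneg: "\<rho> p y \<ge> 0"
  by (simp add: dens_def)

text \<open>The shift from \<open>p\<close> to the zero drift, whose density is 1, applied to the
  constant function 1.\<close>

lemma nn_integral_dens:
  assumes "predictable I r p"
  shows "(\<integral>\<^sup>+y. ennreal (\<rho> p y) \<partial>G) = 1"
proof -
  obtain \<Phi> where "drift_shift p (\<lambda>_ _. 0) \<Phi>"
    using drift_shift_ex[OF assms predictable_const[of "\<lambda>_. 0"]] by auto
  from drift_shift_nn_integral[OF this, of "\<lambda>_. 1"] show ?thesis
    by (simp add: dens_def[of _ _ "\<lambda>_ _. 0"] emeasure_space_1)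
qed

lemma
  assumes "predictable I r p"
  shows integrable_dens: "integrable G (\<rho> p)" and integral_dens: "(\<integral>y. \<rho> p y \<partial>G) = 1"
proof -
  note [measurable] = dens_measurable[OF assms]
  show "integrable G (\<rho> p)"
    by (rule integrableI_nonneg) (auto simp: dens_nonneg nn_integral_dens[OF assms])
  show "(\<integral>y. \<rho> p y \<partial>G) = 1"
    by (subst integral_eq_nn_integral) (auto simp: dens_nonneg nn_integral_dens[OF assms])
qed

text \<open>The exponent of a density is quadratic in the drift, so a power or a product of
  densities is the density of a multiple or a mean of the drifts, times the exponential of an
  explicit quadratic defect. The two identities that follow have the same origin.\<close>

lemma dens_square:
  "(\<rho> p y)\<^sup>2 = exp (v * (\<Sum>a\<in>I. (p a y)\<^sup>2)) * \<rho> (\<lambda>a y. 2 * p a y) y"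
  unfolding dens_def exp_double[symmetric] exp_add[symmetric] sum_distrib_left sum.distrib[symmetric]
  by (intro arg_cong[where f=exp] sum.cong) (auto simp: algebra_simps power2_eq_square)

lemma dens_inverse:
  "1 / \<rho> p y = exp (v * (\<Sum>a\<in>I. (p a y)\<^sup>2)) * \<rho> (\<lambda>a y. - p a y) y"
  unfolding dens_def exp_minus[symmetric] inverse_eq_divide[symmetric] exp_add[symmetric] sum_distrib_left
    sum.distrib[symmetric] sum_negf[symmetric]
  by (intro arg_cong[where f=exp] sum.cong) (auto simp: algebra_simps power2_eq_square)

lemma sqrt_dens_mult:
  "sqrt (\<rho> p y) * sqrt (\<rho> q y) =
     \<rho> (\<lambda>a y. (p a y + q a y) / 2) y * exp (- (v / 8 * (\<Sum>a\<in>I. (p a y - q a y)\<^sup>2)))"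
proof -
  have sqrt_exp: "sqrt (exp x) = exp (x / 2)" for x :: real
    by (rule real_sqrt_unique) (auto simp: power2_eq_square exp_add[symmetric])
  show ?thesis
    unfolding dens_def sqrt_exp exp_add[symmetric] sum_distrib_left sum_negf[symmetric] sum.distrib[symmetric]
      sum_divide_distrib
    by (intro arg_cong[where f=exp] sum.cong) (auto simp: field_simps power2_eq_square)
qed

text \<open>In the exact formulas the remaining Girsanov density has mass 1 and the energy factor is
  at most \<open>exp B\<close>. The square serves Cauchy-Schwarz against a density, the inverse the
  return from a tilted measure to \<open>G\<close>.\<close>

lemma
  assumes p: "predictable I r p" and B: "\<And>y. y \<in> space P \<Longrightarrow> v * (\<Sum>a\<in>I. (p a y)\<^sup>2) \<le> B"
  shows integrable_dens_square: "integrable G (\<lambda>y. (\<rho> p y)\<^sup>2)"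
    and integral_dens_square_le: "(\<integral>y. (\<rho> p y)\<^sup>2 \<partial>G) \<le> exp B"
    and integrable_dens_inverse: "integrable G (\<lambda>y. 1 / \<rho> p y)"
    and integral_dens_inverse_le: "(\<integral>y. 1 / \<rho> p y \<partial>G) \<le> exp B"
proof -
  have p2: "predictable I r (\<lambda>a y. 2 * p a y)" and pm: "predictable I r (\<lambda>a y. - p a y)"
    using predictable_compose2[OF p p, of "\<lambda>x _. 2 * x"] predictable_compose2[OF p p, of "\<lambda>x _. - x"] by simp_all
  note [measurable] = dens_measurable[OF p]
  have b1: "(\<rho> p y)\<^sup>2 \<le> exp B * \<rho> (\<lambda>a y. 2 * p a y) y" if "y \<in> space P" for y
    unfolding dens_square using B[OF that] by (intro mult_right_mono) (auto simp: dens_nonneg)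
  have b2: "1 / \<rho> p y \<le> exp B * \<rho> (\<lambda>a y. - p a y) y" if "y \<in> space P" for y
    unfolding dens_inverse using B[OF that] by (intro mult_right_mono) (auto simp: dens_nonneg)
  have i1: "integrable G (\<lambda>y. exp B * \<rho> (\<lambda>a y. 2 * p a y) y)"
    and i2: "integrable G (\<lambda>y. exp B * \<rho> (\<lambda>a y. - p a y) y)"
    using integrable_dens[OF p2] integrable_dens[OF pm] by simp_all
  show j1: "integrable G (\<lambda>y. (\<rho> p y)\<^sup>2)"
    using b1 by (intro Bochner_Integration.integrable_bound[OF i1]) (auto simp: space_G dens_nonneg)
  show j2: "integrable G (\<lambda>y. 1 / \<rho> p y)"
    using b2 by (intro Bochner_Integration.integrable_bound[OF i2]) (auto simp: space_G dens_nonneg)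
  have "(\<integral>y. (\<rho> p y)\<^sup>2 \<partial>G) \<le> (\<integral>y. exp B * \<rho> (\<lambda>a y. 2 * p a y) y \<partial>G)"
    using b1 by (intro integral_mono j1 i1) (simp add: space_G)
  then show "(\<integral>y. (\<rho> p y)\<^sup>2 \<partial>G) \<le> exp B"
    using integral_dens[OF p2] by simp
  have "(\<integral>y. 1 / \<rho> p y \<partial>G) \<le> (\<integral>y. exp B * \<rho> (\<lambda>a y. - p a y) y \<partial>G)"
    using b2 by (intro integral_mono j2 i2) (simp add: space_G)
  then show "(\<integral>y. 1 / \<rho> p y \<partial>G) \<le> exp B"
    using integral_dens[OF pm] by simp
qed

text \<open>Hellinger bound: \<open>|\<rho>\<^sub>p - \<rho>\<^sub>q|\<close> factors through the square roots, whose product is again a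
  Girsanov density times an explicit deficit.\<close>

lemma dens_L1_dist_le:
  assumes p: "predictable I r p" and q: "predictable I r q"
  shows "(\<integral>y. \<bar>\<rho> p y - \<rho> q y\<bar> \<partial>G) \<le>
    2 * sqrt (2 * (\<integral>y. \<rho> (\<lambda>a y. (p a y + q a y) / 2) y * (1 - exp (- (v / 8 * (\<Sum>a\<in>I. (p a y - q a y)\<^sup>2)))) \<partial>G))"
proof -
  note [measurable] = dens_measurable[OF p] dens_measurable[OF q]
  note ip = integrable_dens[OF p] and iq = integrable_dens[OF q]
  let ?s = "\<lambda>y. sqrt (\<rho> p y) * sqrt (\<rho> q y)"
  have i_s: "integrable G ?s"
    by (rule integral_Cauchy_Schwarz) (auto simp: dens_nonneg ip iq)
  have m: "predictable I r (\<lambda>a y. (p a y + q a y) / 2)"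
    by (rule predictable_compose2[OF p q]) measurable
  note im = integrable_dens[OF m]
  let ?f = "\<lambda>y. \<bar>sqrt (\<rho> p y) - sqrt (\<rho> q y)\<bar>" and ?g = "\<lambda>y. sqrt (\<rho> p y) + sqrt (\<rho> q y)"
  have f2: "(?f y)\<^sup>2 = \<rho> p y + \<rho> q y - 2 * ?s y" and g2: "(?g y)\<^sup>2 = \<rho> p y + \<rho> q y + 2 * ?s y" for y
    by (auto simp: power2_eq_square algebra_simps dens_nonneg)
  have fg: "?f y * ?g y = \<bar>\<rho> p y - \<rho> q y\<bar>" for y
  proof -
    have "?f y * ?g y = \<bar>(sqrt (\<rho> p y) - sqrt (\<rho> q y)) * ?g y\<bar>"
      by (simp add: abs_mult dens_nonneg)
    also have "(sqrt (\<rho> p y) - sqrt (\<rho> q y)) * ?g y = \<rho> p y - \<rho> q y"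
      by (simp add: algebra_simps dens_nonneg)
    finally show ?thesis .
  qed
  have s_nonneg: "0 \<le> (\<integral>y. ?f y ^ 2 \<partial>G)" by (rule integral_nonneg_AE) auto
  have "(\<integral>y. (?g y)\<^sup>2 \<partial>G) \<le> (\<integral>y. 2 * \<rho> p y + 2 * \<rho> q y \<partial>G)"
  proof (rule integral_mono)
    show "integrable G (\<lambda>y. (?g y)\<^sup>2)" unfolding g2 using ip iq i_s by simp
    show "integrable G (\<lambda>y. 2 * \<rho> p y + 2 * \<rho> q y)" using ip iq by simp
    \<comment> \<open>The gap between the two sides is \<open>(?f y)\<^sup>2\<close>.\<close>
    show "(?g y)\<^sup>2 \<le> 2 * \<rho> p y + 2 * \<rho> q y" for y
      using f2[of y] zero_le_power2[of "?f y"] unfolding g2 by linarith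
  qed
  also have "(\<integral>y. 2 * \<rho> p y + 2 * \<rho> q y \<partial>G) = 4"
    using ip iq by (simp add: integral_dens p q)
  finally have g4: "(\<integral>y. (?g y)\<^sup>2 \<partial>G) \<le> 4" .
  have "(\<integral>y. \<bar>\<rho> p y - \<rho> q y\<bar> \<partial>G)\<^sup>2 \<le> (\<integral>y. (?f y)\<^sup>2 \<partial>G) * (\<integral>y. (?g y)\<^sup>2 \<partial>G)"
    unfolding fg[symmetric]
  proof (rule integral_Cauchy_Schwarz)
    show "integrable G (\<lambda>y. (?f y)\<^sup>2)" unfolding f2 using ip iq i_s by simp
    show "integrable G (\<lambda>y. (?g y)\<^sup>2)" unfolding g2 using ip iq i_s by simp
  qed measurable
  also have "\<dots> \<le> (\<integral>y. (?f y)\<^sup>2 \<partial>G) * 4"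
    by (rule mult_left_mono[OF g4 s_nonneg])
  also have "(\<integral>y. (?f y)\<^sup>2 \<partial>G) = 2 - 2 * (\<integral>y. ?s y \<partial>G)"
    unfolding f2 using ip iq i_s by (simp add: integral_dens p q)
  \<comment> \<open>The number 1 is written as the mass of the midpoint density, so that the
    Hellinger deficit becomes a single integral.\<close>
  also have "\<dots> = 2 * ((\<integral>y. \<rho> (\<lambda>a y. (p a y + q a y) / 2) y \<partial>G) - (\<integral>y. ?s y \<partial>G))"
    by (simp add: integral_dens[OF m])
  also have "\<dots> = 2 * (\<integral>y. \<rho> (\<lambda>a y. (p a y + q a y) / 2) y - ?s y \<partial>G)"
    using im i_s by simp
  also have "(\<lambda>y. \<rho> (\<lambda>a y. (p a y + q a y) / 2) y - ?s y) = (\<lambda>y. \<rho> (\<lambda>a y. (p a y + q a y) / 2) y * (1 - exp (- (v / 8 * (\<Sum>a\<in>I. (p a y - q a y)\<^sup>2)))))"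
    by (simp add: sqrt_dens_mult algebra_simps)
  finally have "(\<integral>y. \<bar>\<rho> p y - \<rho> q y\<bar> \<partial>G) \<le> sqrt (2 * (\<integral>y. \<rho> (\<lambda>a y. (p a y + q a y) / 2) y * (1 - exp (- (v / 8 * (\<Sum>a\<in>I. (p a y - q a y)\<^sup>2)))) \<partial>G) * 4)"
    by (rule real_le_rsqrt)
  then show ?thesis by (simp only: real_sqrt_mult[of _ 4] real_sqrt_four mult.commute[of _ 2])
qed

text \<open>For constant coefficients the deficit is deterministic and leaves the integral, and
  \<open>1 - exp (- x) \<le> x\<close> finishes. The bound is linear in the size of
  \<open>c\<close>; this is the rate behind the total variation estimate of order
  \<open>\<epsilon> / sqrt (s t)\<close>.\<close>

lemma dens_L1_dist_const_le:
  "(\<integral>y. \<bar>\<rho> (\<lambda>a _. c a) y - 1\<bar> \<partial>G) \<le> sqrt (v * (\<Sum>a\<in>I. (c a)\<^sup>2))"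
proof -
  let ?S = "\<Sum>a\<in>I. (c a)\<^sup>2"
  have one: "\<rho> (\<lambda>_ _. 0) y = 1" for y by (simp add: dens_def)
  have m: "integrable G (\<rho> (\<lambda>a _. c a / 2))" "(\<integral>y. \<rho> (\<lambda>a _. c a / 2) y \<partial>G) = 1"
    using integrable_dens[OF predictable_const[of "\<lambda>a. c a / 2"]]
      integral_dens[OF predictable_const[of "\<lambda>a. c a / 2"]] by simp_all
  have "(\<integral>y. \<bar>\<rho> (\<lambda>a _. c a) y - 1\<bar> \<partial>G) \<le> 2 * sqrt (2 * (1 - exp (- (v / 8 * ?S))))"
    using dens_L1_dist_le[OF predictable_const[of c] predictable_const[of "\<lambda>_. 0"]] m
    by (simp add: one)
  also have "\<dots> \<le> 2 * sqrt (2 * (v / 8 * ?S))"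
    using exp_ge_add_one_self[of "- (v / 8 * ?S)"] by simp
  also have "\<dots> = sqrt (4 * (2 * (v / 8 * ?S)))"
    by (simp only: real_sqrt_mult) simp
  finally show ?thesis by simp
qed

text \<open>With random coefficients the deficit sits under the midpoint density. Cauchy-Schwarz
  separates the two, so that \<delta> is a bound under \<open>G\<close> itself, at the price of a
  second square root: \<delta> enters to the power 1/4.\<close>

lemma dens_L1_dist_bounded_le:
  assumes p: "predictable I r p" and q: "predictable I r q"
    and Bp: "\<And>y. y \<in> space P \<Longrightarrow> v * (\<Sum>a\<in>I. (p a y)\<^sup>2) \<le> B"
    and Bq: "\<And>y. y \<in> space P \<Longrightarrow> v * (\<Sum>a\<in>I. (q a y)\<^sup>2) \<le> B"
    and \<delta>: "integrable G (\<lambda>y. v * (\<Sum>a\<in>I. (p a y - q a y)\<^sup>2))"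
      "(\<integral>y. v * (\<Sum>a\<in>I. (p a y - q a y)\<^sup>2) \<partial>G) \<le> \<delta>"
  shows "(\<integral>y. \<bar>\<rho> p y - \<rho> q y\<bar> \<partial>G) \<le> 2 * sqrt (2 * sqrt (exp B * \<delta> / 8))"
proof -
  let ?m = "\<lambda>a y. (p a y + q a y) / 2" and ?S = "\<lambda>y. \<Sum>a\<in>I. (p a y - q a y)\<^sup>2"
  let ?e = "\<lambda>y. 1 - exp (- (v / 8 * ?S y))"
  have m: "predictable I r ?m"
    by (rule predictable_compose2[OF p q]) measurable
  note [measurable] = dens_measurable[OF m] predictable_measurable[OF p] predictable_measurable[OF q]
  \<comment> \<open>Convexity of the square: the midpoint drift obeys the same energy bound.\<close>
  have Bm: "v * (\<Sum>a\<in>I. (?m a y)\<^sup>2) \<le> B" if y: "y \<in> space P" for y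
  proof -
    have "(\<Sum>a\<in>I. (?m a y)\<^sup>2) \<le> (\<Sum>a\<in>I. (1/2) * (p a y)\<^sup>2 + (1/2) * (q a y)\<^sup>2)"
    proof (rule sum_mono)
      fix a
      have "(1/2) * (p a y)\<^sup>2 + (1/2) * (q a y)\<^sup>2 - (?m a y)\<^sup>2 = ((p a y - q a y) / 2)\<^sup>2"
        by (simp add: power2_eq_square field_simps)
      then show "(?m a y)\<^sup>2 \<le> (1/2) * (p a y)\<^sup>2 + (1/2) * (q a y)\<^sup>2"
        using zero_le_power2[of "(p a y - q a y) / 2"] by linarith
    qed
    also have "\<dots> = (1/2) * (\<Sum>a\<in>I. (p a y)\<^sup>2) + (1/2) * (\<Sum>a\<in>I. (q a y)\<^sup>2)"
      by (simp add: sum.distrib sum_distrib_left)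
    finally have "v * (\<Sum>a\<in>I. (?m a y)\<^sup>2) \<le> v * ((1/2) * (\<Sum>a\<in>I. (p a y)\<^sup>2) + (1/2) * (\<Sum>a\<in>I. (q a y)\<^sup>2))"
      using v by (intro mult_left_mono) auto
    also have "\<dots> \<le> B" using Bp[OF y] Bq[OF y] by (simp add: algebra_simps)
    finally show ?thesis .
  qed
  have S_nonneg: "0 \<le> v / 8 * ?S y" for y using v by (simp add: sum_nonneg)
  have e: "0 \<le> ?e y" "?e y \<le> 1" "?e y \<le> v / 8 * ?S y" for y
    using S_nonneg[of y] exp_ge_add_one_self[of "- (v / 8 * ?S y)"] by (auto simp del: zero_le_mult_iff zero_le_divide_iff)
  \<comment> \<open>As \<open>?e y\<close> lies in [0, 1], its square is at most
    \<open>?e y\<close>, which is linear in the squared drift distance; a mean of that distance is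
    all that \<delta> provides.\<close>
  have e2: "(?e y)\<^sup>2 \<le> (1/8) * (v * ?S y)" for y
  proof -
    have "(?e y)\<^sup>2 \<le> ?e y * 1" unfolding power2_eq_square[of "?e y"] by (rule mult_left_mono[OF e(2,1)])
    with e(3)[of y] show ?thesis by simp
  qed
  have ie: "integrable G (\<lambda>y. (?e y)\<^sup>2)"
  proof (rule integrable_const_bound[where B=1])
    show "AE x in G. norm ((?e x)\<^sup>2) \<le> 1"
      using e by (intro always_eventually allI) (simp add: power_le_one)
  qed measurable
  have \<delta>8: "(\<integral>y. (?e y)\<^sup>2 \<partial>G) \<le> \<delta> / 8"
  proof -
    have "(\<integral>y. (?e y)\<^sup>2 \<partial>G) \<le> (\<integral>y. (1/8) * (v * ?S y) \<partial>G)"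
      using \<delta>(1) by (intro integral_mono ie e2) simp
    also have "\<dots> = (1/8) * (\<integral>y. v * ?S y \<partial>G)"
      using \<delta>(1) by (rule Bochner_Integration.integral_mult_right)
    finally show ?thesis using \<delta>(2) by simp
  qed
  have "(\<integral>y. \<rho> ?m y * ?e y \<partial>G)\<^sup>2 \<le> (\<integral>y. (\<rho> ?m y)\<^sup>2 \<partial>G) * (\<integral>y. (?e y)\<^sup>2 \<partial>G)"
    by (rule integral_Cauchy_Schwarz(2)) (use integrable_dens_square[OF m Bm] ie in \<open>measurable\<close>)
  also have "\<dots> \<le> exp B * (\<delta> / 8)"
    using integral_dens_square_le[OF m Bm] \<delta>8 by (intro mult_mono) auto
  finally have "(\<integral>y. \<rho> ?m y * ?e y \<partial>G) \<le> sqrt (exp B * \<delta> / 8)"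
    by (intro real_le_rsqrt) simp
  then have "2 * sqrt (2 * (\<integral>y. \<rho> ?m y * ?e y \<partial>G)) \<le> 2 * sqrt (2 * sqrt (exp B * \<delta> / 8))"
    by simp
  then show ?thesis
    using dens_L1_dist_le[OF p q] by linarith
qed

text \<open>Cauchy-Schwarz with \<open>D = sqrt (D \<rho>) sqrt (D / \<rho>)\<close>.\<close>

lemma integral_bounded_le_dens:
  assumes p: "predictable I r p" and B: "\<And>y. y \<in> space P \<Longrightarrow> v * (\<Sum>a\<in>I. (p a y)\<^sup>2) \<le> B"
    and [measurable]: "D \<in> borel_measurable P" and D: "\<And>y. y \<in> space P \<Longrightarrow> 0 \<le> D y \<and> D y \<le> 1"
  shows "(\<integral>y. D y \<partial>G)\<^sup>2 \<le> exp B * (\<integral>y. D y * \<rho> p y \<partial>G)"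
proof -
  note [measurable] = dens_measurable[OF p]
  let ?f = "\<lambda>y. sqrt (\<bar>D y\<bar> * \<rho> p y)" and ?g = "\<lambda>y. sqrt (\<bar>D y\<bar> * (1 / \<rho> p y))"
  have f2: "(?f y)\<^sup>2 = \<bar>D y\<bar> * \<rho> p y" and g2: "(?g y)\<^sup>2 = \<bar>D y\<bar> * (1 / \<rho> p y)" for y
    using dens_nonneg[of p y] by simp_all
  have D1: "\<bar>D y\<bar> \<le> 1" if "y \<in> space P" for y using D[OF that] by simp
  have i1: "integrable G (\<lambda>y. \<bar>D y\<bar> * \<rho> p y)"
    by (rule Bochner_Integration.integrable_bound[OF integrable_dens[OF p]])
       (auto simp: space_G dens_nonneg abs_mult intro!: AE_I2 mult_left_le_one_le D1)
  have i2: "integrable G (\<lambda>y. \<bar>D y\<bar> * (1 / \<rho> p y))"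
    by (rule Bochner_Integration.integrable_bound[OF integrable_dens_inverse[OF p B]])
       (auto simp: space_G dens_nonneg abs_mult intro!: AE_I2 divide_right_mono D1)
  have "(\<integral>y. D y \<partial>G) = (\<integral>y. ?f y * ?g y \<partial>G)"
  proof (intro Bochner_Integration.integral_cong refl)
    fix y assume "y \<in> space G"
    then have "D y \<ge> 0" using D by (simp add: space_G)
    then show "D y = ?f y * ?g y"
      using dens_pos[of p y] by (simp add: real_sqrt_mult[symmetric])
  qed
  then have "(\<integral>y. D y \<partial>G)\<^sup>2 = (\<integral>y. ?f y * ?g y \<partial>G)\<^sup>2" by simp
  also have "\<dots> \<le> (\<integral>y. (?f y)\<^sup>2 \<partial>G) * (\<integral>y. (?g y)\<^sup>2 \<partial>G)"
    by (rule integral_Cauchy_Schwarz(2)) (simp_all only: f2 g2 i1 i2, measurable)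
  also have "\<dots> = (\<integral>y. \<bar>D y\<bar> * \<rho> p y \<partial>G) * (\<integral>y. \<bar>D y\<bar> * (1 / \<rho> p y) \<partial>G)"
    by (simp only: f2 g2)
  also have "\<dots> \<le> (\<integral>y. \<bar>D y\<bar> * \<rho> p y \<partial>G) * exp B"
  proof (rule mult_left_mono)
    have "(\<integral>y. \<bar>D y\<bar> * (1 / \<rho> p y) \<partial>G) \<le> (\<integral>y. 1 / \<rho> p y \<partial>G)"
      by (intro integral_mono i2 integrable_dens_inverse[OF p B])
         (auto simp: space_G dens_nonneg intro!: divide_right_mono D1)
    then show "(\<integral>y. \<bar>D y\<bar> * (1 / \<rho> p y) \<partial>G) \<le> exp B"
      using integral_dens_inverse_le[OF p B] by linarith
    show "0 \<le> (\<integral>y. \<bar>D y\<bar> * \<rho> p y \<partial>G)"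
      by (rule integral_nonneg_AE) (simp add: dens_nonneg)
  qed
  also have "(\<integral>y. \<bar>D y\<bar> * \<rho> p y \<partial>G) = (\<integral>y. D y * \<rho> p y \<partial>G)"
    using D by (intro Bochner_Integration.integral_cong) (auto simp: space_G)
  finally show ?thesis by (simp add: mult.commute)
qed

lemma integral_shift:
  assumes shift: "drift_shift p q \<Phi>"
    and p: "predictable I r p" and q: "predictable I r q"
    and f: "f \<in> borel_measurable P" "\<And>y. y \<in> space P \<Longrightarrow> 0 \<le> f y \<and> f y \<le> (c::real)"
  shows "integrable G (\<lambda>y. f (\<Phi> y) * \<rho> p y)" "integrable G (\<lambda>y. f y * \<rho> q y)"
    and "(\<integral>y. f (\<Phi> y) * \<rho> p y \<partial>G) = (\<integral>y. f y * \<rho> q y \<partial>G)"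
proof -
  note \<Phi> = drift_shift_measurable[OF shift]
  note [measurable] = f(1) \<Phi> dens_measurable[OF p] dens_measurable[OF q]
  have \<Phi>s: "\<Phi> y \<in> space P" if "y \<in> space P" for y
    using that \<Phi> by (rule measurable_space[rotated])
  have bound: "integrable G (\<lambda>y. g y * \<rho> p' y)"
    if [measurable]: "g \<in> borel_measurable P" and g: "\<And>y. y \<in> space P \<Longrightarrow> 0 \<le> g y \<and> g y \<le> c"
      and p': "predictable I r p'" for g p'
  proof (rule Bochner_Integration.integrable_bound)
    note [measurable] = dens_measurable[OF p']
    show "(\<lambda>y. g y * \<rho> p' y) \<in> borel_measurable G" by measurable
    show "integrable G (\<lambda>y. c * \<rho> p' y)" using integrable_dens[OF p'] by simp
    have "norm (g y * \<rho> p' y) \<le> norm (c * \<rho> p' y)" if "y \<in> space P" for y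
      using g[OF that] by (auto simp: abs_mult dens_nonneg intro!: mult_right_mono)
    then show "AE y in G. norm (g y * \<rho> p' y) \<le> norm (c * \<rho> p' y)"
      by (intro AE_I2) (simp add: space_G)
  qed
  show "integrable G (\<lambda>y. f (\<Phi> y) * \<rho> p y)" by (rule bound) (use f \<Phi>s p in auto)
  show "integrable G (\<lambda>y. f y * \<rho> q y)" by (rule bound) (use f q in auto)
  have "(\<integral>y. f (\<Phi> y) * \<rho> p y \<partial>G) = enn2real (\<integral>\<^sup>+y. ennreal (f (\<Phi> y) * \<rho> p y) \<partial>G)"
    using f(2) \<Phi>s by (intro integral_eq_nn_integral) (auto simp: space_G dens_nonneg)
  also have "(\<integral>\<^sup>+y. ennreal (f (\<Phi> y) * \<rho> p y) \<partial>G) = (\<integral>\<^sup>+y. ennreal (f (\<Phi> y)) * ennreal (\<rho> p y) \<partial>G)"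
    using f(2) \<Phi>s by (intro nn_integral_cong) (simp add: ennreal_mult space_G dens_nonneg)
  also have "\<dots> = (\<integral>\<^sup>+y. ennreal (f y) * ennreal (\<rho> q y) \<partial>G)"
    by (rule drift_shift_nn_integral[OF shift, of "\<lambda>y. ennreal (f y)"]) measurable
  also have "\<dots> = (\<integral>\<^sup>+y. ennreal (f y * \<rho> q y) \<partial>G)"
    using f(2) by (intro nn_integral_cong) (simp add: ennreal_mult space_G dens_nonneg)
  also have "enn2real \<dots> = (\<integral>y. f y * \<rho> q y \<partial>G)"
    using f(2) by (intro integral_eq_nn_integral[symmetric]) (auto simp: space_G dens_nonneg)
  finally show "(\<integral>y. f (\<Phi> y) * \<rho> p y \<partial>G) = (\<integral>y. f y * \<rho> q y \<partial>G)" .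
qed

text \<open>The order \<open>f y \<le> f (\<Phi> y)\<close> is decisive: equality of weighted laws
  says nothing about both values at the same \<open>y\<close>, but a difference of constant sign is
  controlled by its mean. Under the \<open>p\<close>-tilt that mean is the integral of
  \<open>f y * (\<rho> q y - \<rho> p y)\<close>.\<close>

lemma dominating_shift_le:
  assumes shift: "drift_shift p q \<Phi>"
    and p: "predictable I r p" and q: "predictable I r q"
    and Bp: "\<And>y. y \<in> space P \<Longrightarrow> v * (\<Sum>a\<in>I. (p a y)\<^sup>2) \<le> B"
    and Bq: "\<And>y. y \<in> space P \<Longrightarrow> v * (\<Sum>a\<in>I. (q a y)\<^sup>2) \<le> B"
    and \<delta>: "integrable G (\<lambda>y. v * (\<Sum>a\<in>I. (q a y - p a y)\<^sup>2))"
      "(\<integral>y. v * (\<Sum>a\<in>I. (q a y - p a y)\<^sup>2) \<partial>G) \<le> \<delta>"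
    and f: "f \<in> borel_measurable P" "\<And>y. y \<in> space P \<Longrightarrow> 0 \<le> f y \<and> f y \<le> (1::real)"
    and le: "\<And>y. y \<in> space P \<Longrightarrow> f y \<le> f (\<Phi> y)"
  shows "(\<integral>y. f (\<Phi> y) - f y \<partial>G)\<^sup>2 \<le> exp B * (2 * sqrt (2 * sqrt (exp B * \<delta> / 8)))"
proof -
  note \<Phi> = drift_shift_measurable[OF shift]
  note [measurable] = f(1) \<Phi> dens_measurable[OF p] dens_measurable[OF q]
  have \<Phi>s: "\<Phi> y \<in> space P" if "y \<in> space P" for y
    using that \<Phi> by (rule measurable_space[rotated])
  note int = integral_shift[OF shift p q f]
  have f1: "\<bar>f y\<bar> \<le> 1" if "y \<in> space P" for y using f(2)[OF that] by auto
  have ip: "integrable G (\<lambda>y. f y * \<rho> p y)"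
    by (rule Bochner_Integration.integrable_bound[OF integrable_dens[OF p]])
       (auto simp: space_G dens_nonneg abs_mult intro!: AE_I2 mult_left_le_one_le f1)
  have "(\<integral>y. f (\<Phi> y) - f y \<partial>G)\<^sup>2 \<le> exp B * (\<integral>y. (f (\<Phi> y) - f y) * \<rho> p y \<partial>G)"
  proof (rule integral_bounded_le_dens[OF p Bp])
    show "0 \<le> f (\<Phi> y) - f y \<and> f (\<Phi> y) - f y \<le> 1" if "y \<in> space P" for y
      using le[OF that] f(2)[OF that] f(2)[OF \<Phi>s[OF that]] by auto
  qed measurable
  also have "(\<integral>y. (f (\<Phi> y) - f y) * \<rho> p y \<partial>G) = (\<integral>y. f y * \<rho> q y \<partial>G) - (\<integral>y. f y * \<rho> p y \<partial>G)"
    using int ip by (simp add: left_diff_distrib)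
  also have "\<dots> = (\<integral>y. f y * (\<rho> q y - \<rho> p y) \<partial>G)"
    using int ip by (simp add: right_diff_distrib)
  also have "\<dots> \<le> (\<integral>y. \<bar>\<rho> q y - \<rho> p y\<bar> \<partial>G)"
  proof (rule integral_mono)
    show "integrable G (\<lambda>y. f y * (\<rho> q y - \<rho> p y))"
      using int ip by (simp add: right_diff_distrib)
    show "integrable G (\<lambda>y. \<bar>\<rho> q y - \<rho> p y\<bar>)"
      using integrable_dens[OF p] integrable_dens[OF q] by simp
    fix y assume "y \<in> space G"
    then have "0 \<le> f y" "f y \<le> 1" using f(2) by (auto simp: space_G)
    then have "f y * (\<rho> q y - \<rho> p y) \<le> f y * \<bar>\<rho> q y - \<rho> p y\<bar>" "f y * \<bar>\<rho> q y - \<rho> p y\<bar> \<le> \<bar>\<rho> q y - \<rho> p y\<bar>"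
      by (auto intro: mult_left_mono mult_left_le_one_le)
    then show "f y * (\<rho> q y - \<rho> p y) \<le> \<bar>\<rho> q y - \<rho> p y\<bar>" by simp
  qed
  also have "\<dots> \<le> 2 * sqrt (2 * sqrt (exp B * \<delta> / 8))"
    by (rule dens_L1_dist_bounded_le[OF q p Bq Bp \<delta>])
  finally show ?thesis by simp
qed

end

section \<open>The dominating scheme on a grid\<close>

lemma borel_measurable_vecI:
  fixes f :: "'a \<Rightarrow> real^'d"
  assumes "\<And>i. (\<lambda>x. f x $ i) \<in> borel_measurable M"
  shows "f \<in> borel_measurable M"
  unfolding borel_measurable_euclidean_space[of f]
  using assms by (auto simp: Basis_vec_def inner_axis)

lemma borel_measurable_vec_nth:
  "(\<lambda>x::real^'d. x $ i) \<in> borel_measurable borel"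
  by (intro borel_measurable_continuous_onI continuous_intros)

text \<open>The summand for \<open>j = 0\<close> vanishes because \<open>1 / 0 = 0\<close>.\<close>

lemma sum_inverse_sqrt_le: "(\<Sum>j<Suc m. 1 / sqrt (real j)) \<le> 2 * sqrt (real m)"
proof (induction m)
  case (Suc m)
  let ?a = "sqrt (real (Suc m))" and ?b = "sqrt (real m)"
  have pos: "?a > 0" "?b \<ge> 0" "?b \<le> ?a" by auto
  have "(?a - ?b) * (?a + ?b) = 1"
    by (simp add: algebra_simps)
  moreover have "(?a - ?b) * (?a + ?b) \<le> (?a - ?b) * (2 * ?a)"
    using pos by (intro mult_left_mono) auto
  ultimately have "1 \<le> (2 * (?a - ?b)) * ?a" by (simp only: mult_ac)
  then have "1 / ?a \<le> 2 * (?a - ?b)"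
    by (rule mult_imp_div_pos_le[OF pos(1)])
  then show ?case using Suc by simp
qed simp

lemma sum_inverse_sqrt_lessThan_le: "(\<Sum>j<n. 1 / sqrt (real j)) \<le> 2 * sqrt (real n)"
proof (cases n)
  case (Suc m)
  then show ?thesis using sum_inverse_sqrt_le[of m]
    by (smt (verit) real_sqrt_le_mono of_nat_mono lessI less_imp_le)
qed simp

text \<open>The bound of \<open>dominating_shift_le\<close> for energy bound
  \<open>d * C\<^sup>2\<close> and mean squared drift distance
  \<open>2 * C * (d * (4 * C / n + 16 * C * \<epsilon> * sqrt d))\<close>, with \<open>d\<close> the
  dimension. The term in \<open>1 / n\<close> comes from the cells along the axes, the term in
  \<epsilon> from all others.\<close>

definition scheme_gap :: "real \<Rightarrow> real \<Rightarrow> nat \<Rightarrow> real \<Rightarrow> real" where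
  "scheme_gap d C n \<epsilon> = exp (d * C\<^sup>2) *
     (2 * sqrt (2 * sqrt (exp (d * C\<^sup>2) * (2 * C * (d * (4 * C / real n + 16 * C * \<epsilon> * sqrt d))) / 8)))"

text \<open>Only cells strictly below \<open>j\<close> and \<open>k\<close> are summed: this is the
  value at the lower left corner of cell \<open>(j, k)\<close> of a path that has increments
  \<open>y\<close> and vanishes on the axes.\<close>

definition walk :: "('d \<times> nat \<times> nat \<Rightarrow> real) \<Rightarrow> nat \<Rightarrow> nat \<Rightarrow> real^'d" where
  "walk y j k = (\<chi> i. \<Sum>j'<j. \<Sum>k'<k. y (i, j', k'))"

text \<open>\<open>B j k\<close> abstracts the average of the drift over a cell. Everything in this
  locale is finite-dimensional; the sheet and the field \<open>b\<close> enter only later.\<close>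

locale drift_grid =
  fixes n :: nat and C \<epsilon> :: real and B :: "nat \<Rightarrow> nat \<Rightarrow> real^'d \<Rightarrow> real^'d"
  assumes n: "n > 0" and \<epsilon>: "\<epsilon> \<ge> 0"
    and B_meas: "\<And>j k. B j k \<in> borel_measurable borel"
    and B_bound: "\<And>j k x i. \<bar>B j k x $ i\<bar> \<le> C"
    and B_mono: "\<And>j k x y i. (\<And>i. x $ i \<le> y $ i) \<Longrightarrow> B j k x $ i \<le> B j k y $ i"
begin

abbreviation "cells \<equiv> (UNIV :: 'd set) \<times> {..<n} \<times> {..<n}"

text \<open>The variance of an increment is the area of a cell. The rank is the first index alone,
  since the walk at \<open>(j, k)\<close> reads only cells with smaller first index.\<close>

sublocale gauss_product "1 / (real n)\<^sup>2" cells "\<lambda>(i, j, k). j"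
  by standard (use n in auto)

definition drift :: "real \<Rightarrow> 'd \<times> nat \<times> nat \<Rightarrow> ('d \<times> nat \<times> nat \<Rightarrow> real) \<Rightarrow> real" where
  "drift c a y = (case a of (i, j, k) \<Rightarrow> B j k (walk y j k + vec c) $ i)"

lemma C_nonneg: "C \<ge> 0"
  using B_bound[of 0 0 0] abs_ge_zero order_trans by blast

lemma walk_measurable:
  assumes "\<And>i j' k'. j' < j \<Longrightarrow> k' < k \<Longrightarrow> (i, j', k') \<in> S"
  shows "(\<lambda>y. walk y j k) \<in> borel_measurable (Pi\<^sub>M S (\<lambda>_. borel))"
  by (rule borel_measurable_vecI)
     (auto simp: walk_def intro!: borel_measurable_sum measurable_component_singleton assms)

lemma drift_measurable:
  assumes "\<And>i j' k'. j' < j \<Longrightarrow> k' < k \<Longrightarrow> (i, j', k') \<in> S"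
  shows "drift c (i, j, k) \<in> borel_measurable (Pi\<^sub>M S (\<lambda>_. borel))"
proof -
  have "(\<lambda>y. walk y j k + vec c) \<in> borel_measurable (Pi\<^sub>M S (\<lambda>_. borel))"
    by (intro borel_measurable_add walk_measurable assms) auto
  from measurable_compose[OF measurable_compose[OF this B_meas] borel_measurable_vec_nth]
  show ?thesis unfolding drift_def by simp
qed

lemma predictable_drift: "predictable cells (\<lambda>(i, j, k). j) (drift c)"
  unfolding predictable_def
proof (intro ballI conjI allI impI)
  fix a S assume a: "a \<in> cells"
    and S: "{b \<in> cells. (case b of (i, j, k) \<Rightarrow> j) < (case a of (i, j, k) \<Rightarrow> j)} \<subseteq> S"
  obtain i j k where [simp]: "a = (i, j, k)" by (cases a)
  have "(i', j', k') \<in> S" if "j' < j" "k' < k" for i' j' k'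
    using a that by (intro subsetD[OF S]) auto
  then show "drift c a \<in> borel_measurable (Pi\<^sub>M S (\<lambda>_. borel))"
    by (simp add: drift_measurable)
next
  fix a and y y' :: "'d \<times> nat \<times> nat \<Rightarrow> real"
  assume a: "a \<in> cells"
    and y: "\<forall>b\<in>cells. (case b of (i, j, k) \<Rightarrow> j) < (case a of (i, j, k) \<Rightarrow> j) \<longrightarrow> y b = y' b"
  obtain i j k where [simp]: "a = (i, j, k)" by (cases a)
  have "walk y j k = walk y' j k"
    using a y unfolding walk_def by (intro arg_cong[where f=vec_lambda] ext sum.cong) auto
  then show "drift c a y = drift c a y'" by (simp add: drift_def)
qed

lemma drift_bound: "\<bar>drift c a y\<bar> \<le> C"
  unfolding drift_def using B_bound by (auto split: prod.split)

lemma drift_mono: "c \<le> c' \<Longrightarrow> drift c a y \<le> drift c' a y"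
  unfolding drift_def by (auto split: prod.split intro!: B_mono)

text \<open>There are \<open>d * n\<^sup>2\<close> coordinates, each weighted by the area
  \<open>1 / n\<^sup>2\<close>, so the energy bound does not depend on the mesh.\<close>

lemma sum_drift_square_le: "1 / (real n)\<^sup>2 * (\<Sum>a\<in>cells. (drift c a y)\<^sup>2) \<le> real CARD('d) * C\<^sup>2"
proof -
  have "(\<Sum>a\<in>cells. (drift c a y)\<^sup>2) \<le> (\<Sum>a\<in>cells. C\<^sup>2)"
    by (intro sum_mono) (metis drift_bound abs_le_square_iff abs_of_nonneg[OF C_nonneg])
  then have "1 / (real n)\<^sup>2 * (\<Sum>a\<in>cells. (drift c a y)\<^sup>2) \<le> 1 / (real n)\<^sup>2 * (real CARD('d) * (real n)\<^sup>2 * C\<^sup>2)"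
    by (intro mult_left_mono) (auto simp: card_cartesian_product power2_eq_square mult_ac)
  then show ?thesis using n by simp
qed

text \<open>A constant drift \<open>\<theta>\<close> on the cells below \<open>(j, k)\<close> moves the walk from \<open>W - \<epsilon>\<close> to \<open>W + \<epsilon>\<close>.\<close>

lemma expectation_drift_diff_le:
  assumes ijk: "(i, j, k) \<in> cells" and jk: "j > 0" "k > 0"
  shows "(\<integral>y. drift \<epsilon> (i, j, k) y - drift (- \<epsilon>) (i, j, k) y \<partial>G)
    \<le> 4 * C * \<epsilon> * sqrt (real CARD('d)) * real n / (sqrt (real j) * sqrt (real k))"
proof -
  \<comment> \<open>Each of the \<open>j * k\<close> cells displaces its increment by
    \<open>\<theta> / n\<^sup>2\<close>, in total by \<open>2 * \<epsilon>\<close>. All components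
    are shifted, since one component of \<open>B\<close> depends on the whole vector; this is the
    origin of the factor \<open>sqrt d\<close>.\<close>
  define \<theta> where "\<theta> = 2 * \<epsilon> * (real n)\<^sup>2 / (real j * real k)"
  define c where "c a = (case a of (i'::'d, j', k') \<Rightarrow> if j' < j \<and> k' < k then \<theta> else 0)" for a
  let ?r = "\<lambda>(i::'d, j::nat, k::nat). j"
  have z: "predictable cells ?r (\<lambda>_ _. 0)" and pc: "predictable cells ?r (\<lambda>a _. c a)"
    using predictable_const[of "\<lambda>_. 0"] predictable_const[of c] by simp_all
  obtain \<Phi> where \<Phi>: "drift_shift (\<lambda>_ _. 0) (\<lambda>a _. c a) \<Phi>"
    using drift_shift_ex[OF z pc] by blast
  \<comment> \<open>Adding \<open>C\<close> gives values in \<open>[0, 2 * C]\<close>, as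
    \<open>integral_shift\<close> requires; the constant cancels in the difference.\<close>
  let ?f = "\<lambda>y. drift (- \<epsilon>) (i, j, k) y + C"
  have fm: "?f \<in> borel_measurable P"
    using ijk by (intro borel_measurable_add drift_measurable) auto
  have dm: "drift \<epsilon> (i, j, k) \<in> borel_measurable P"
    using ijk by (intro drift_measurable) auto
  note [measurable] = fm dm
  have f: "0 \<le> ?f y" "?f y \<le> 2 * C" for y
    using drift_bound[of "- \<epsilon>" "(i, j, k)" y] by (auto simp: abs_le_iff)
  have walk_shift: "walk (\<Phi> y) j k = walk y j k + vec (2 * \<epsilon>)" if y: "y \<in> space P" for y
  proof -
    have "walk (\<Phi> y) j k $ i' = walk y j k $ i' + 2 * \<epsilon>" for i'
    proof -
      have "walk (\<Phi> y) j k $ i' = (\<Sum>j'<j. \<Sum>k'<k. y (i', j', k') + 1 / (real n)\<^sup>2 * \<theta>)"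
        unfolding walk_def vec_lambda_beta using ijk drift_shift_apply[OF \<Phi> y]
        by (intro sum.cong refl) (auto simp: c_def)
      also have "\<dots> = walk y j k $ i' + real j * real k * (1 / (real n)\<^sup>2 * \<theta>)"
        by (simp add: walk_def sum.distrib)
      finally show ?thesis using jk n by (simp add: \<theta>_def)
    qed
    then show ?thesis by (simp add: vec_eq_iff)
  qed
  have \<Phi>f: "?f (\<Phi> y) = drift \<epsilon> (i, j, k) y + C" if "y \<in> space P" for y
  proof -
    have "walk y j k + vec (2 * \<epsilon>) + vec (- \<epsilon>) = walk y j k + vec \<epsilon>"
      by (simp add: vec_eq_iff)
    then show ?thesis by (simp only: drift_def prod.case walk_shift[OF that])
  qed
  have one: "dens v' cells (\<lambda>_ _. 0) y = 1" for v' and y :: "'d \<times> nat \<times> nat \<Rightarrow> real"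
    by (simp add: dens_def)
  note int = integral_shift[OF \<Phi> z pc fm, of "2 * C"]
  have int1: "integrable G (\<lambda>y. ?f y * \<rho> (\<lambda>a _. c a) y)"
    and int2: "(\<integral>y. ?f (\<Phi> y) \<partial>G) = (\<integral>y. ?f y * \<rho> (\<lambda>a _. c a) y \<partial>G)"
    using int f by (simp_all add: one)
  have bdd: "integrable G (drift c' (i, j, k))" for c'
    using ijk drift_bound by (intro integrable_const_bound[where B=C] AE_I2 drift_measurable)
      (auto simp: measurable_cong_sets[OF sets_G refl] intro!: drift_measurable)
  have "(\<integral>y. drift \<epsilon> (i, j, k) y - drift (- \<epsilon>) (i, j, k) y \<partial>G)
      = (\<integral>y. drift \<epsilon> (i, j, k) y + C \<partial>G) - (\<integral>y. ?f y \<partial>G)"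
    using bdd by simp
  also have "(\<integral>y. drift \<epsilon> (i, j, k) y + C \<partial>G) = (\<integral>y. ?f (\<Phi> y) \<partial>G)"
    by (intro Bochner_Integration.integral_cong refl) (simp only: space_G \<Phi>f)
  also have "\<dots> = (\<integral>y. ?f y * \<rho> (\<lambda>a _. c a) y \<partial>G)" by (rule int2)
  also have "\<dots> - (\<integral>y. ?f y \<partial>G) = (\<integral>y. ?f y * \<rho> (\<lambda>a _. c a) y - ?f y \<partial>G)"
    using int1 bdd by (intro Bochner_Integration.integral_diff[symmetric]) auto
  also have "\<dots> \<le> (\<integral>y. 2 * C * \<bar>\<rho> (\<lambda>a _. c a) y - 1\<bar> \<partial>G)"
  proof (rule integral_mono)
    show "integrable G (\<lambda>y. ?f y * \<rho> (\<lambda>a _. c a) y - ?f y)"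
      using int1 bdd by (intro Bochner_Integration.integrable_diff) auto
    show "integrable G (\<lambda>y. 2 * C * \<bar>\<rho> (\<lambda>a _. c a) y - 1\<bar>)"
      using integrable_dens[OF pc] by (intro integrable_mult_right integrable_abs Bochner_Integration.integrable_diff) auto
    fix y
    have "?f y * \<rho> (\<lambda>a _. c a) y - ?f y = ?f y * (\<rho> (\<lambda>a _. c a) y - 1)" by (simp add: algebra_simps)
    also have "\<dots> \<le> ?f y * \<bar>\<rho> (\<lambda>a _. c a) y - 1\<bar>" using f(1)[of y] by (intro mult_left_mono) auto
    also have "\<dots> \<le> 2 * C * \<bar>\<rho> (\<lambda>a _. c a) y - 1\<bar>" using f(2)[of y] by (intro mult_right_mono) auto
    finally show "?f y * \<rho> (\<lambda>a _. c a) y - ?f y \<le> 2 * C * \<bar>\<rho> (\<lambda>a _. c a) y - 1\<bar>" .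
  qed
  also have "\<dots> = 2 * C * (\<integral>y. \<bar>\<rho> (\<lambda>a _. c a) y - 1\<bar> \<partial>G)"
    by simp
  also have "\<dots> \<le> 2 * C * sqrt (1 / (real n)\<^sup>2 * (\<Sum>a\<in>cells. (c a)\<^sup>2))"
    using dens_L1_dist_const_le[of c] C_nonneg by (intro mult_left_mono) auto
  also have "(\<Sum>a\<in>cells. (c a)\<^sup>2) = (\<Sum>a\<in>(UNIV::'d set) \<times> {..<j} \<times> {..<k}. \<theta>\<^sup>2)"
    using ijk by (intro sum.mono_neutral_cong_right) (auto simp: c_def split: if_splits)
  also have "\<dots> = real CARD('d) * (real j * real k) * \<theta>\<^sup>2"
    by (simp add: card_cartesian_product)
  \<comment> \<open>This is the squared displacement \<open>2 * \<epsilon>\<close> over the variance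
    \<open>j * k / n\<^sup>2\<close> of the walk, once per component.\<close>
  also have "1 / (real n)\<^sup>2 * (real CARD('d) * (real j * real k) * \<theta>\<^sup>2) = real CARD('d) * (2 * \<epsilon> * real n)\<^sup>2 / (real j * real k)"
    using jk n by (simp add: \<theta>_def power2_eq_square)
  also have "sqrt \<dots> = sqrt (real CARD('d)) * (2 * \<epsilon> * real n) / (sqrt (real j) * sqrt (real k))"
    using \<epsilon> by (simp add: real_sqrt_mult real_sqrt_divide)
  finally show ?thesis by (simp add: mult_ac)
qed

lemma drift_integrable: "a \<in> cells \<Longrightarrow> integrable G (drift c a)"
  using drift_bound predictable_measurable[OF predictable_drift]
  by (intro integrable_const_bound[where B=C] AE_I2) (auto simp: measurable_cong_sets[OF sets_G refl])

text \<open>The singularity \<open>1 / sqrt (j * k)\<close> is summable: its double sum is at most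
  \<open>4 * n\<close>. The indicators count the cells along the two axes, \<open>2 * n\<close> in
  all with the corner counted twice.\<close>

lemma sum_inner_le:
  "(\<Sum>j<n. \<Sum>k<n. 2 * C * ((if j = 0 then 1 else 0) + (if k = 0 then 1 else 0))
      + K * (1 / sqrt (real j)) * (1 / sqrt (real k))) \<le> 4 * C * real n + 4 * K * real n"
  if "K \<ge> 0"
proof -
  have z: "(\<Sum>j<n. if j = 0 then 1 else 0 :: real) = 1"
    using n by (simp add: sum.delta)
  have "(\<Sum>j<n. \<Sum>k<n. 2 * C * ((if j = 0 then 1 else 0) + (if k = 0 then 1 else 0))
      + K * (1 / sqrt (real j)) * (1 / sqrt (real k)))
    = 4 * C * real n + K * ((\<Sum>j<n. 1 / sqrt (real j)) * (\<Sum>k<n. 1 / sqrt (real k)))"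
    unfolding sum_product
    by (simp add: sum.distrib sum_distrib_left[symmetric] z mult.assoc) (simp add: sum_distrib_left mult_ac)
  also have "\<dots> \<le> 4 * C * real n + K * ((2 * sqrt (real n)) * (2 * sqrt (real n)))"
    using that by (intro add_left_mono mult_left_mono mult_mono sum_inverse_sqrt_lessThan_le) (auto intro!: sum_nonneg)
  finally show ?thesis by simp
qed

text \<open>The drift difference lies in \<open>[0, 2 * C]\<close> by monotonicity, so its square is
  at most \<open>2 * C\<close> times itself and first moments are enough.\<close>

lemma
  shows integrable_drift_dist: "integrable G (\<lambda>y. 1 / (real n)\<^sup>2 * (\<Sum>a\<in>cells. (drift \<epsilon> a y - drift (- \<epsilon>) a y)\<^sup>2))"
    and integral_drift_dist_le: "(\<integral>y. 1 / (real n)\<^sup>2 * (\<Sum>a\<in>cells. (drift \<epsilon> a y - drift (- \<epsilon>) a y)\<^sup>2) \<partial>G) \<le> 2 * C * (real CARD('d) * (4 * C / real n + 16 * C * \<epsilon> * sqrt (real CARD('d))))"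
proof -
  let ?q = "\<lambda>a y. drift \<epsilon> a y - drift (- \<epsilon>) a y"
  let ?v = "1 / (real n)\<^sup>2"
  have q0: "0 \<le> ?q a y" for a y using drift_mono[of "- \<epsilon>" \<epsilon> a y] \<epsilon> by simp
  have q2: "?q a y \<le> 2 * C" for a y
    using drift_bound[of \<epsilon> a y] drift_bound[of "- \<epsilon>" a y] by (auto simp: abs_le_iff)
  have sq: "(?q a y)\<^sup>2 \<le> 2 * C * ?q a y" for a y
    unfolding power2_eq_square by (rule mult_right_mono[OF q2 q0])
  have iq: "integrable G (?q a)" if "a \<in> cells" for a
    using drift_integrable[OF that] by simp
  have isq: "integrable G (\<lambda>y. (?q a y)\<^sup>2)" if a: "a \<in> cells" for a
  proof (rule Bochner_Integration.integrable_bound)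
    show "integrable G (\<lambda>y. 2 * C * ?q a y)" using iq[OF a] by simp
    show "(\<lambda>y. (?q a y)\<^sup>2) \<in> borel_measurable G"
      using iq[OF a] by (intro borel_measurable_power borel_measurable_integrable)
    show "AE y in G. norm ((?q a y)\<^sup>2) \<le> norm (2 * C * ?q a y)"
      using sq q0 C_nonneg by (intro AE_I2) (simp add: abs_mult)
  qed
  show "integrable G (\<lambda>y. ?v * (\<Sum>a\<in>cells. (?q a y)\<^sup>2))"
    using isq by (intro integrable_mult_right Bochner_Integration.integrable_sum) auto
  let ?K = "4 * C * \<epsilon> * sqrt (real CARD('d)) * real n"
  have K: "?K \<ge> 0" using C_nonneg \<epsilon> by simp
  \<comment> \<open>On the axes the walk is 0, there is no noise to smooth the drift, and only the
    trivial bound is available; after weighting by the cell area these cells contribute order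
    \<open>1 / n\<close>.\<close>
  have each: "(\<integral>y. ?q (i, j, k) y \<partial>G) \<le> 2 * C * ((if j = 0 then 1 else 0) + (if k = 0 then 1 else 0))
      + ?K * (1 / sqrt (real j)) * (1 / sqrt (real k))" if a: "(i, j, k) \<in> cells" for i j k
  proof (cases "j = 0 \<or> k = 0")
    case True
    have "(\<integral>y. ?q (i, j, k) y \<partial>G) \<le> (\<integral>y. 2 * C \<partial>G)"
      by (intro integral_mono iq a q2) simp
    also have "\<dots> = 2 * C" by (simp add: prob_space)
    finally show ?thesis using True C_nonneg by (auto simp: add_increasing2)
  next
    case False
    then show ?thesis using expectation_drift_diff_le[OF a] by simp
  qed
  have "(\<Sum>a\<in>cells. \<integral>y. ?q a y \<partial>G) = (\<Sum>i\<in>UNIV. \<Sum>j<n. \<Sum>k<n. \<integral>y. ?q (i, j, k) y \<partial>G)"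
    by (simp add: sum.cartesian_product)
  also have "\<dots> \<le> (\<Sum>i\<in>(UNIV::'d set). \<Sum>j<n. \<Sum>k<n. 2 * C * ((if j = 0 then 1 else 0) + (if k = 0 then 1 else 0))
      + ?K * (1 / sqrt (real j)) * (1 / sqrt (real k)))"
    by (intro sum_mono each) auto
  also have "\<dots> \<le> (\<Sum>i\<in>(UNIV::'d set). 4 * C * real n + 4 * ?K * real n)"
    by (intro sum_mono sum_inner_le K)
  also have "\<dots> = real CARD('d) * (4 * C * real n + 4 * ?K * real n)" by simp
  finally have sum_q: "(\<Sum>a\<in>cells. \<integral>y. ?q a y \<partial>G) \<le> real CARD('d) * (4 * C * real n + 4 * ?K * real n)" .
  have "(\<Sum>a\<in>cells. \<integral>y. (?q a y)\<^sup>2 \<partial>G) \<le> (\<Sum>a\<in>cells. \<integral>y. 2 * C * ?q a y \<partial>G)"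
    using isq iq sq by (intro sum_mono integral_mono) auto
  also have "\<dots> = 2 * C * (\<Sum>a\<in>cells. \<integral>y. ?q a y \<partial>G)"
    unfolding sum_distrib_left by simp
  also have "\<dots> \<le> 2 * C * (real CARD('d) * (4 * C * real n + 4 * ?K * real n))"
    using C_nonneg by (intro mult_left_mono sum_q) simp
  finally have sum_q2: "(\<Sum>a\<in>cells. \<integral>y. (?q a y)\<^sup>2 \<partial>G)
    \<le> 2 * C * (real CARD('d) * (4 * C * real n + 4 * ?K * real n))" .
  have "(\<integral>y. ?v * (\<Sum>a\<in>cells. (?q a y)\<^sup>2) \<partial>G) = ?v * (\<Sum>a\<in>cells. \<integral>y. (?q a y)\<^sup>2 \<partial>G)"
    using isq by (subst Bochner_Integration.integral_mult_right)
      (auto intro!: Bochner_Integration.integrable_sum Bochner_Integration.integral_sum)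
  also have "\<dots> \<le> ?v * (2 * C * (real CARD('d) * (4 * C * real n + 4 * ?K * real n)))"
    by (rule mult_left_mono[OF sum_q2]) simp
  also have "\<dots> = 2 * C * (real CARD('d) * (4 * C / real n + 16 * C * \<epsilon> * sqrt (real CARD('d))))"
    using n by (simp add: field_simps power2_eq_square)
  finally show "(\<integral>y. ?v * (\<Sum>a\<in>cells. (?q a y)\<^sup>2) \<partial>G) \<le> 2 * C * (real CARD('d) * (4 * C / real n + 16 * C * \<epsilon> * sqrt (real CARD('d))))" .
qed

text \<open>Summing the coordinate identity of the shift over the cells below \<open>(j, k)\<close>
  gives the Euler scheme, since \<open>q\<close> is evaluated at the image \<open>\<Phi> y\<close>.
  Domination is an induction on \<open>j\<close> alone: the recursion reads only strictly smaller
  indices and \<open>B\<close> is nondecreasing.\<close>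

lemma dominating_scheme_ex:
  "\<exists>\<Phi>\<in>P \<rightarrow>\<^sub>M P.
     (\<forall>y\<in>space P. \<forall>j\<le>n. \<forall>k\<le>n. \<forall>i. walk (\<Phi> y) j k $ i = walk y j k $ i + 1 / (real n)\<^sup>2 *
        (\<Sum>j'<j. \<Sum>k'<k. B j' k' (walk (\<Phi> y) j' k' + vec \<epsilon>) $ i - B j' k' (walk y j' k' + vec (- \<epsilon>)) $ i)) \<and>
     (\<forall>y\<in>space P. \<forall>j\<le>n. \<forall>k\<le>n. \<forall>i. walk y j k $ i \<le> walk (\<Phi> y) j k $ i) \<and>
     (\<forall>j\<le>n. \<forall>k\<le>n. \<forall>i. \<forall>g. mono g \<longrightarrow> (\<forall>x. 0 \<le> g x \<and> g x \<le> (1::real)) \<longrightarrow> g \<in> borel_measurable borel \<longrightarrow>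
        (\<integral>y. g (walk (\<Phi> y) j k $ i) - g (walk y j k $ i) \<partial>G)\<^sup>2 \<le> scheme_gap (real CARD('d)) C n \<epsilon>)"
proof -
  let ?v = "1 / (real n)\<^sup>2"
  obtain \<Phi> where \<Phi>: "drift_shift (drift (- \<epsilon>)) (drift \<epsilon>) \<Phi>"
    using drift_shift_ex[OF predictable_drift predictable_drift] by blast
  have eq: "walk (\<Phi> y) j k $ i = walk y j k $ i + ?v *
      (\<Sum>j'<j. \<Sum>k'<k. B j' k' (walk (\<Phi> y) j' k' + vec \<epsilon>) $ i - B j' k' (walk y j' k' + vec (- \<epsilon>)) $ i)"
    if y: "y \<in> space P" and jk: "j \<le> n" "k \<le> n" for y j k i
  proof -
    have "walk (\<Phi> y) j k $ i = (\<Sum>j'<j. \<Sum>k'<k. y (i, j', k') + ?v *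
      (B j' k' (walk (\<Phi> y) j' k' + vec \<epsilon>) $ i - B j' k' (walk y j' k' + vec (- \<epsilon>)) $ i))"
      unfolding walk_def[of "\<Phi> y" j k] vec_lambda_beta using jk drift_shift_apply[OF \<Phi> y]
      by (intro sum.cong refl) (auto simp: drift_def)
    then show ?thesis by (simp add: walk_def[of y j k] sum.distrib sum_distrib_left)
  qed
  have le: "walk y j k $ i \<le> walk (\<Phi> y) j k $ i" if y: "y \<in> space P" and "j \<le> n" "k \<le> n" for y j k i
    using that(2,3)
  proof (induction j arbitrary: k i rule: less_induct)
    case (less j)
    have "0 \<le> (\<Sum>j'<j. \<Sum>k'<k. B j' k' (walk (\<Phi> y) j' k' + vec \<epsilon>) $ i - B j' k' (walk y j' k' + vec (- \<epsilon>)) $ i)"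
    proof (intro sum_nonneg)
      fix j' k' assume "j' \<in> {..<j}" "k' \<in> {..<k}"
      then have "walk y j' k' $ i' \<le> walk (\<Phi> y) j' k' $ i'" for i' using less by simp
      then have "B j' k' (walk y j' k' + vec (- \<epsilon>)) $ i \<le> B j' k' (walk (\<Phi> y) j' k' + vec \<epsilon>) $ i"
        using \<epsilon> by (intro B_mono) (simp add: add_increasing)
      then show "0 \<le> B j' k' (walk (\<Phi> y) j' k' + vec \<epsilon>) $ i - B j' k' (walk y j' k' + vec (- \<epsilon>)) $ i" by simp
    qed
    then show ?case unfolding eq[OF y less.prems] by simp
  qed
  have est: "(\<integral>y. g (walk (\<Phi> y) j k $ i) - g (walk y j k $ i) \<partial>G)\<^sup>2 \<le> scheme_gap (real CARD('d)) C n \<epsilon>"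
    if jk: "j \<le> n" "k \<le> n" and g: "mono g" "\<And>x. 0 \<le> g x \<and> g x \<le> (1::real)" "g \<in> borel_measurable borel" for j k i g
    unfolding scheme_gap_def
  proof (rule dominating_shift_le[OF \<Phi> predictable_drift predictable_drift])
    have "(\<lambda>y. walk y j k) \<in> borel_measurable P"
      using jk by (intro walk_measurable) auto
    from measurable_compose[OF measurable_compose[OF this borel_measurable_vec_nth] g(3)]
    show "(\<lambda>y. g (walk y j k $ i)) \<in> borel_measurable P" .
    show "g (walk y j k $ i) \<le> g (walk (\<Phi> y) j k $ i)" if "y \<in> space P" for y
      using le[OF that jk] g(1) by (auto dest: monoD)
  qed (use g(2) sum_drift_square_le integrable_drift_dist integral_drift_dist_le in auto)
  show ?thesis
    using drift_shift_measurable[OF \<Phi>] eq le est by (intro bexI[of _ \<Phi>]) auto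
qed

end

section \<open>Grid increments of a Brownian sheet\<close>

lemma brownian_sheetD:
  assumes "brownian_sheet M F W"
  shows "prob_space M" "filtration2 M F"
    and "\<And>i s t. s \<in> {0..1} \<Longrightarrow> t \<in> {0..1} \<Longrightarrow> (\<lambda>\<omega>. W s t \<omega> $ i) \<in> borel_measurable (F s t)"
    and "\<And>\<omega>. \<omega> \<in> space M \<Longrightarrow> continuous_on ({0..1} \<times> {0..1}) (\<lambda>(s,t). W s t \<omega>)"
    and "\<And>\<omega> s. \<omega> \<in> space M \<Longrightarrow> s \<in> {0..1} \<Longrightarrow> W 0 s \<omega> = 0 \<and> W s 0 \<omega> = 0"
    and "prob_space.indep_vars M (\<lambda>i. Pi\<^sub>M ({0..1} \<times> {0..1}) (\<lambda>_. borel))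
        (\<lambda>i \<omega>. \<lambda>p\<in>{0..1} \<times> {0..1}. W (fst p) (snd p) \<omega> $ i) UNIV"
    and "\<And>i s s' t t'. 0 \<le> s \<Longrightarrow> s < s' \<Longrightarrow> s' \<le> 1 \<Longrightarrow> 0 \<le> t \<Longrightarrow> t < t' \<Longrightarrow> t' \<le> 1 \<Longrightarrow>
        distributed M lborel (rect_incr (\<lambda>a b \<omega>. W a b \<omega> $ i) s s' t t')
          (normal_density 0 (sqrt ((s' - s) * (t' - t))))"
    and "\<And>i s s' t t'. 0 \<le> s \<Longrightarrow> s < s' \<Longrightarrow> s' \<le> 1 \<Longrightarrow> 0 \<le> t \<Longrightarrow> t < t' \<Longrightarrow> t' \<le> 1 \<Longrightarrow>
        prob_space.indep_set M
          {(rect_incr (\<lambda>a b \<omega>. W a b \<omega> $ i) s s' t t') -` B \<inter> space M | B. B \<in> sets borel}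
          (sigma_sets (space M) (sets (F s 1) \<union> sets (F 1 t)))"
  using assms unfolding brownian_sheet_def by simp_all

text \<open>A centred Gaussian is symmetric, and an increment and its negative generate the same
  events. This serves the lower bound on solutions.\<close>

lemma brownian_sheet_uminus:
  assumes W: "brownian_sheet M F W"
  shows "brownian_sheet M F (\<lambda>s t \<omega>. - W s t \<omega>)"
proof -
  note D = brownian_sheetD[OF W]
  interpret prob_space M by (rule D(1))
  \<comment> \<open>The shape \<open>0 + (- 1) * X\<close> is the one that
    \<open>normal_density_affine\<close> produces.\<close>
  have rect: "rect_incr (\<lambda>a b \<omega>. (- W a b \<omega>) $ i) s s' t t' = (\<lambda>\<omega>. 0 + (- 1) * rect_incr (\<lambda>a b \<omega>. W a b \<omega> $ i) s s' t t' \<omega>)" for i s s' t t'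
    by (auto simp: rect_incr_def)
  have set_eq: "{(\<lambda>\<omega>. 0 + (- 1) * X \<omega>) -` B \<inter> space M | B. B \<in> sets borel} = {X -` B \<inter> space M | B. B \<in> sets borel}"
    for X :: "'a \<Rightarrow> real"
  proof -
    have neg: "uminus -` B \<in> sets borel" if "B \<in> sets borel" for B :: "real set"
    proof -
      have "(uminus :: real \<Rightarrow> real) \<in> borel_measurable borel" by measurable
      from measurable_sets[OF this that] show ?thesis by simp
    qed
    have 1: "(\<lambda>\<omega>. 0 + (- 1) * X \<omega>) -` B \<inter> space M = X -` (uminus -` B) \<inter> space M"
      and 2: "X -` B \<inter> space M = (\<lambda>\<omega>. 0 + (- 1) * X \<omega>) -` (uminus -` B) \<inter> space M" for B
      by auto
    show ?thesis
    proof (intro equalityI subsetI; elim CollectE exE conjE)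
      fix E B assume "E = (\<lambda>\<omega>. 0 + (- 1) * X \<omega>) -` B \<inter> space M" "B \<in> sets borel"
      then show "E \<in> {X -` B \<inter> space M | B. B \<in> sets borel}"
        unfolding 1 by (intro CollectI exI[of _ "uminus -` B"]) (simp add: neg)
    next
      fix E B assume "E = X -` B \<inter> space M" "B \<in> sets borel"
      then show "E \<in> {(\<lambda>\<omega>. 0 + (- 1) * X \<omega>) -` B \<inter> space M | B. B \<in> sets borel}"
        unfolding 2 by (intro CollectI exI[of _ "uminus -` B"]) (simp add: neg)
    qed
  qed
  have comp: "indep_vars (\<lambda>i. Pi\<^sub>M ({0..1} \<times> {0..1}) (\<lambda>_. borel))
        (\<lambda>i \<omega>. \<lambda>p\<in>{0..1} \<times> {0..1}. (- W (fst p) (snd p) \<omega>) $ i) UNIV"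
  proof -
    have "indep_vars (\<lambda>i. Pi\<^sub>M ({0..1} \<times> {0..1}) (\<lambda>_. borel))
        (\<lambda>i \<omega>. (\<lambda>f. \<lambda>p\<in>{0..1} \<times> {0..1}. - f p) (\<lambda>p\<in>{0..1} \<times> {0..1}. W (fst p) (snd p) \<omega> $ i)) UNIV"
      using D(6) by (rule indep_vars_compose2) measurable
    then show ?thesis by (simp cong: restrict_cong)
  qed
  show ?thesis
    unfolding brownian_sheet_def rect set_eq
  proof (intro conjI allI impI ballI)
    show "prob_space M" "filtration2 M F" by (rule D)+
    show "(\<lambda>\<omega>. (- W s t \<omega>) $ i) \<in> borel_measurable (F s t)" if "s \<in> {0..1}" "t \<in> {0..1}" for i s t
      using borel_measurable_uminus[OF D(3)[OF that, of i]] by simp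
    show "continuous_on ({0..1} \<times> {0..1}) (\<lambda>(s,t). - W s t \<omega>)" if "\<omega> \<in> space M" for \<omega>
      using continuous_on_minus[OF D(4)[OF that]] by (simp add: case_prod_unfold)
    show "- W 0 r \<omega> = 0" "- W r 0 \<omega> = 0" if "\<omega> \<in> space M" "r \<in> {0..1}" for \<omega> r
      using D(5)[OF that] by simp_all
    show "distributed M lborel (\<lambda>\<omega>. 0 + (- 1) * rect_incr (\<lambda>a b \<omega>. W a b \<omega> $ i) s s' t t' \<omega>)
          (normal_density 0 (sqrt ((s' - s) * (t' - t))))"
      if "0 \<le> s" "s < s'" "s' \<le> 1" "0 \<le> t" "t < t'" "t' \<le> 1" for i s s' t t'
      using normal_density_affine[OF D(7)[OF that, of i], of "-1" 0] that by simp
  qed (use comp D(8) in auto)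
qed

definition grid_incr :: "(real \<Rightarrow> real \<Rightarrow> 'a \<Rightarrow> real^'d) \<Rightarrow> nat \<Rightarrow> 'a \<Rightarrow> 'd \<times> nat \<times> nat \<Rightarrow> real" where
  "grid_incr W n \<omega> = (\<lambda>(i, j, k)\<in>UNIV \<times> {..<n} \<times> {..<n}.
     rect_incr (\<lambda>a b \<omega>. W a b \<omega> $ i) (real j / real n) (real (Suc j) / real n)
       (real k / real n) (real (Suc k) / real n) \<omega>)"

lemma grid_point: "n > 0 \<Longrightarrow> j \<le> n \<Longrightarrow> real j / real n \<in> {0..1}"
  by (simp add: divide_le_eq)

text \<open>In lexicographic order every earlier cell lies to the left of or below the current one, so its increment is
  measurable with respect to the sigma-algebra that the current increment is independent of.\<close>

lemma prob_rect_incr_INT: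
  fixes W :: "real \<Rightarrow> real \<Rightarrow> 'a \<Rightarrow> real^'d" and i :: 'd
  assumes W: "brownian_sheet M F W" and n: "n > 0"
    and J: "finite J" "J \<subseteq> {..<n} \<times> {..<n}" and A: "\<And>c. c \<in> J \<Longrightarrow> A c \<in> sets borel"
  defines "X \<equiv> \<lambda>c. rect_incr (\<lambda>a b \<omega>. W a b \<omega> $ i) (real (fst c) / real n) (real (Suc (fst c)) / real n)
       (real (snd c) / real n) (real (Suc (snd c)) / real n)"
  shows "measure M {\<omega>\<in>space M. \<forall>c\<in>J. X c \<omega> \<in> A c} = (\<Prod>c\<in>J. measure M (X c -` A c \<inter> space M))"
proof -
  note D = brownian_sheetD[OF W]
  interpret prob_space M by (rule D(1))
  have filt: "sets (F s t) \<subseteq> sets (F s' t')" "space (F s t) = space (F s' t')" "space (F s t) = space M"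
    if "s \<in> {0..1}" "t \<in> {0..1}" "s' \<in> {0..1}" "t' \<in> {0..1}" "s \<le> s'" "t \<le> t'" for s t s' t'
    using D(2)[unfolded filtration2_def] that by simp_all
  have meas: "X c \<in> borel_measurable (F s t)"
    if c: "c \<in> {..<n} \<times> {..<n}" and st: "s \<in> {0..1}" "t \<in> {0..1}"
      "real (Suc (fst c)) / real n \<le> s" "real (Suc (snd c)) / real n \<le> t" for c s t
  proof -
    have corner: "(\<lambda>\<omega>. W s' t' \<omega> $ i) \<in> borel_measurable (F s t)"
      if "s' \<in> {0..1}" "t' \<in> {0..1}" "s' \<le> s" "t' \<le> t" for s' t'
      by (rule borel_measurable_subalgebra[OF filt(1,2)[OF that(1,2) st(1,2) that(3,4)] D(3)[OF that(1,2)]])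
    have "real (fst c) / real n \<le> real (Suc (fst c)) / real n" "real (snd c) / real n \<le> real (Suc (snd c)) / real n"
      by (auto intro: divide_right_mono)
    with st c n show ?thesis
      unfolding X_def rect_incr_def
      by (intro borel_measurable_add borel_measurable_diff corner grid_point) (auto intro: order_trans)
  qed
  show ?thesis
    using J(1) A J(2)
  proof (induction J rule: finite_ranking_induct[where f = "\<lambda>(j, k). j * n + k"])
    case empty
    then show ?case by (simp add: prob_space)
  next
    case (insert x S)
    show ?case
    proof (cases "x \<in> S")
      case True
      then show ?thesis using insert by (simp add: insert_absorb)
    next
      case False
      obtain j k where x: "x = (j, k)" by (cases x)
      have jk: "j < n" "k < n" using insert.prems x by auto
      define N where "N = sigma (space M) (sets (F (real j / real n) 1) \<union> sets (F 1 (real k / real n)))"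
      have F_sub: "sets (F (real j / real n) 1) \<union> sets (F 1 (real k / real n)) \<subseteq> Pow (space M)"
        using filt(3)[of "real j / real n" 1 1 1] filt(3)[of 1 "real k / real n" 1 1] jk n
          sets.space_closed[of "F (real j / real n) 1"] sets.space_closed[of "F 1 (real k / real n)"]
        by (auto simp: divide_le_eq)
      have setsN: "sets N = sigma_sets (space M) (sets (F (real j / real n) 1) \<union> sets (F 1 (real k / real n)))"
        and spaceN: "space N = space M"
        unfolding N_def using F_sub by (simp_all add: sets_measure_of space_measure_of_conv)
      have XN: "{\<omega>\<in>space N. X c \<omega> \<in> A c} \<in> sets N" if c: "c \<in> S" for c
      proof -
        obtain j' k' where c': "c = (j', k')" by (cases c)
        have in_grid: "c \<in> {..<n} \<times> {..<n}" using insert.prems c by auto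
        have "j' * n + k' \<le> j * n + k" using insert.hyps(2)[OF c] x c' by simp
        moreover have "(j', k') \<noteq> (j, k)" using False c c' x by auto
        ultimately have "j' < j \<or> (j' = j \<and> k' < k)"
        proof -
          assume le: "j' * n + k' \<le> j * n + k" and ne: "(j', k') \<noteq> (j, k)"
          \<comment> \<open>A larger first index raises the rank by at least \<open>n\<close>, more
            than \<open>k < n\<close> can compensate.\<close>
          have "\<not> j < j'"
          proof
            assume "j < j'"
            then have "Suc j * n \<le> j' * n" by (intro mult_right_mono) auto
            then show False using le jk by simp
          qed
          then show ?thesis using le ne by (cases "j' = j") auto
        qed
        then consider "Suc j' \<le> j" | "Suc k' \<le> k" by linarith
        then have "X c -` A c \<inter> space M \<in> sets (F (real j / real n) 1) \<union> sets (F 1 (real k / real n))"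
        proof cases
          case 1
          have "X c \<in> borel_measurable (F (real j / real n) 1)"
            using 1 jk n in_grid c' by (intro meas) (auto simp: divide_le_eq divide_right_mono)
          from measurable_sets[OF this, of "A c"] show ?thesis
            using insert.prems(1) c filt(3)[of "real j / real n" 1 1 1] jk n by (auto simp: divide_le_eq)
        next
          case 2
          have "X c \<in> borel_measurable (F 1 (real k / real n))"
            using 2 jk n in_grid c' by (intro meas) (auto simp: divide_le_eq divide_right_mono)
          from measurable_sets[OF this, of "A c"] show ?thesis
            using insert.prems(1) c filt(3)[of 1 "real k / real n" 1 1] jk n by (auto simp: divide_le_eq)
        qed
        moreover have "X c -` A c \<inter> space M = {\<omega>\<in>space N. X c \<omega> \<in> A c}"
          by (auto simp: spaceN)
        ultimately show ?thesis unfolding setsN by (auto intro: sigma_sets.Basic)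
      qed
      have ES: "{\<omega>\<in>space M. \<forall>c\<in>S. X c \<omega> \<in> A c} \<in> sigma_sets (space M) (sets (F (real j / real n) 1) \<union> sets (F 1 (real k / real n)))"
      proof -
        have "{\<omega>\<in>space N. \<forall>c\<in>S. X c \<omega> \<in> A c} \<in> sets N"
          by (rule sets.sets_Collect_finite_All) (auto intro: XN insert.hyps(1))
        then show ?thesis unfolding setsN spaceN .
      qed
      have "indep_set {X x -` B \<inter> space M | B. B \<in> sets borel}
          (sigma_sets (space M) (sets (F (real j / real n) 1) \<union> sets (F 1 (real k / real n))))"
        unfolding X_def x fst_conv snd_conv
        using jk n by (intro D(8)) (auto simp: divide_le_eq divide_strict_right_mono)
      then have "prob ((X x -` A x \<inter> space M) \<inter> {\<omega>\<in>space M. \<forall>c\<in>S. X c \<omega> \<in> A c})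
         = prob (X x -` A x \<inter> space M) * prob {\<omega>\<in>space M. \<forall>c\<in>S. X c \<omega> \<in> A c}"
        by (rule indep_setD) (use insert.prems ES in auto)
      moreover have "(X x -` A x \<inter> space M) \<inter> {\<omega>\<in>space M. \<forall>c\<in>S. X c \<omega> \<in> A c} = {\<omega>\<in>space M. \<forall>c\<in>insert x S. X c \<omega> \<in> A c}"
        by auto
      ultimately show ?thesis
        using insert False by simp
    qed
  qed
qed

text \<open>Independence comes from two sources: within a component from the preceding lemma, across
  components from the independence of whole paths. Together with the Gaussian marginals this
  identifies the joint law.\<close>

lemma distr_grid_incr:
  fixes W :: "real \<Rightarrow> real \<Rightarrow> 'a \<Rightarrow> real^'d"
  assumes W: "brownian_sheet M F W" and n: "n > 0"
  defines "I \<equiv> (UNIV :: 'd set) \<times> {..<n} \<times> {..<n}"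
  shows "grid_incr W n \<in> M \<rightarrow>\<^sub>M Pi\<^sub>M I (\<lambda>_. borel)"
    and "distr M (Pi\<^sub>M I (\<lambda>_. borel)) (grid_incr W n) = Pi\<^sub>M I (\<lambda>_. gauss (1 / (real n)\<^sup>2))"
proof -
  note D = brownian_sheetD[OF W]
  interpret prob_space M by (rule D(1))
  define X where "X a = (case a of (i, j, k) \<Rightarrow> rect_incr (\<lambda>a b \<omega>. W a b \<omega> $ i) (real j / real n) (real (Suc j) / real n)
       (real k / real n) (real (Suc k) / real n))" for a
  let ?J = "{..<n} \<times> {..<n}"
  have law: "distributed M lborel (X a) (normal_density 0 (sqrt (1 / (real n)\<^sup>2)))" if a: "a \<in> I" for a
  proof -
    obtain i j k where [simp]: "a = (i, j, k)" by (cases a)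
    have "(real (Suc j) / real n - real j / real n) * (real (Suc k) / real n - real k / real n) = 1 / (real n)\<^sup>2"
      by (simp add: diff_divide_distrib[symmetric] power2_eq_square)
    moreover have "distributed M lborel (X a) (normal_density 0 (sqrt ((real (Suc j) / real n - real j / real n) * (real (Suc k) / real n - real k / real n))))"
      unfolding X_def using a n by (auto simp: I_def divide_le_eq divide_strict_right_mono intro!: D(7))
    ultimately show ?thesis by simp
  qed
  have Xm: "X a \<in> borel_measurable M" if "a \<in> I" for a
    using distributed_measurable[OF law[OF that]] by simp
  have I: "finite I" "I \<noteq> {}" using n by (auto simp: I_def)
  have grid: "grid_incr W n = (\<lambda>\<omega>. \<lambda>a\<in>I. X a \<omega>)"
    unfolding grid_incr_def I_def X_def by (intro ext) (auto simp: restrict_def)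
  show "grid_incr W n \<in> M \<rightarrow>\<^sub>M Pi\<^sub>M I (\<lambda>_. borel)"
    unfolding grid by (intro measurable_restrict Xm)
  have "indep_vars (\<lambda>_. borel) X I"
  proof (subst indep_vars_finite[OF I(2,1), where E = "\<lambda>_. sets borel"])
    show "\<forall>A\<in>(\<Pi> a\<in>I. sets borel). prob (\<Inter>a\<in>I. X a -` A a \<inter> space M) = (\<Prod>a\<in>I. prob (X a -` A a \<inter> space M))"
    proof
      fix A assume A: "A \<in> (\<Pi> a\<in>I. sets (borel :: real measure))"
      let ?Pi = "Pi\<^sub>M ({0..1} \<times> {0..1}) (\<lambda>_. borel) :: (real \<times> real \<Rightarrow> real) measure"
      let ?pt = "\<lambda>j k. (real j / real n, real k / real n)"
      \<comment> \<open>Independence of the components is about whole paths, so the conditions on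
        the increments of component \<open>i\<close> are expressed as a measurable set
        \<open>A' i\<close> of paths.\<close>
      define R where "R c f = f (?pt (Suc (fst c)) (Suc (snd c))) - f (?pt (fst c) (Suc (snd c))) - f (?pt (Suc (fst c)) (snd c)) + f (?pt (fst c) (snd c))"
        for c and f :: "real \<times> real \<Rightarrow> real"
      define A' where "A' i = {f\<in>space ?Pi. \<forall>c\<in>?J. R c f \<in> A (i, c)}" for i
      let ?path = "\<lambda>i \<omega>. \<lambda>p\<in>{0..1} \<times> {0..1}. W (fst p) (snd p) \<omega> $ i"
      have R: "R c (?path i \<omega>) = X (i, c) \<omega>" if "c \<in> ?J" for c i \<omega>
        using that n unfolding R_def X_def by (cases c) (simp add: rect_incr_def divide_le_eq)
      have A': "A' i \<in> sets ?Pi" for i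
        unfolding A'_def
      proof (rule sets.sets_Collect_finite_All)
        fix c assume c: "c \<in> ?J"
        have "R c \<in> borel_measurable ?Pi"
          unfolding R_def using c n
          by (intro borel_measurable_add borel_measurable_diff measurable_component_singleton) (auto simp: divide_le_eq)
        then show "{f\<in>space ?Pi. R c f \<in> A (i, c)} \<in> sets ?Pi"
          using A c by (intro measurable_sets_Collect[of "R c" _ borel]) (auto simp: I_def Pi_iff pred_def)
      qed simp
      have ev: "?path i -` A' i \<inter> space M = {\<omega>\<in>space M. \<forall>c\<in>?J. X (i, c) \<omega> \<in> A (i, c)}" for i
      proof -
        have "?path i \<omega> \<in> space ?Pi" for \<omega> by (simp add: space_PiM)
        then show ?thesis unfolding A'_def using R by auto
      qed
      have "(\<Inter>a\<in>I. X a -` A a \<inter> space M) = (\<Inter>i\<in>UNIV. ?path i -` A' i \<inter> space M)"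
        unfolding ev using I by (auto simp: I_def)
      also have "prob \<dots> = (\<Prod>i\<in>UNIV. prob (?path i -` A' i \<inter> space M))"
        using D(6) by (rule indep_varsD_finite) (auto simp: A')
      also have "\<dots> = (\<Prod>i\<in>UNIV. \<Prod>c\<in>?J. prob (X (i, c) -` A (i, c) \<inter> space M))"
      proof (rule prod.cong[OF refl])
        fix i :: 'd
        have "prob {\<omega>\<in>space M. \<forall>c\<in>?J. X (i, c) \<omega> \<in> A (i, c)} = (\<Prod>c\<in>?J. prob (X (i, c) -` A (i, c) \<inter> space M))"
          using prob_rect_incr_INT[OF W n, of ?J "\<lambda>c. A (i, c)" i] A
          by (auto simp: X_def I_def Pi_iff case_prod_unfold)
        then show "prob (?path i -` A' i \<inter> space M) = (\<Prod>c\<in>?J. prob (X (i, c) -` A (i, c) \<inter> space M))"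
          unfolding ev .
      qed
      also have "\<dots> = (\<Prod>a\<in>I. prob (X a -` A a \<inter> space M))"
        unfolding I_def by (simp add: prod.cartesian_product)
      finally show "prob (\<Inter>a\<in>I. X a -` A a \<inter> space M) = (\<Prod>a\<in>I. prob (X a -` A a \<inter> space M))" .
    qed
  qed (auto simp: Xm Int_stable_def sets.sigma_sets_eq[of borel, simplified])
  then have "distr M (Pi\<^sub>M I (\<lambda>_. borel)) (\<lambda>\<omega>. \<lambda>a\<in>I. X a \<omega>) = (\<Pi>\<^sub>M a\<in>I. distr M borel (X a))"
    using indep_vars_iff_distr_eq_PiM'[OF I(2), of X "\<lambda>_. borel"] Xm by simp
  also have "\<dots> = Pi\<^sub>M I (\<lambda>_. gauss (1 / (real n)\<^sup>2))"
  proof (rule PiM_cong[OF refl])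
    fix a assume "a \<in> I"
    have "distr M borel (X a) = distr M lborel (X a)" by (intro distr_cong) auto
    also have "\<dots> = gauss (1 / (real n)\<^sup>2)"
      unfolding gauss_def using distributed_distr_eq_density[OF law[OF \<open>a \<in> I\<close>]] by simp
    finally show "distr M borel (X a) = gauss (1 / (real n)\<^sup>2)" .
  qed
  finally show "distr M (Pi\<^sub>M I (\<lambda>_. borel)) (grid_incr W n) = Pi\<^sub>M I (\<lambda>_. gauss (1 / (real n)\<^sup>2))"
    unfolding grid .
qed

section \<open>Domination of solutions\<close>

text \<open>Half-open intervals, so that the cells below \<open>(j, k)\<close> tile the rectangle
  without overlap and miss only the axes, where solutions vanish.\<close>

definition cell :: "nat \<Rightarrow> nat \<Rightarrow> nat \<Rightarrow> (real \<times> real) set" where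
  "cell n j k = {real j / real n <.. real (Suc j) / real n} \<times> {real k / real n <.. real (Suc k) / real n}"

lemma cell_sets [measurable]: "cell n j k \<in> sets borel"
  unfolding cell_def borel_prod[symmetric] by measurable

lemma emeasure_cell: "emeasure lborel (cell n j k) = ennreal (1 / (real n)\<^sup>2)"
proof -
  have le: "real j / real n \<le> real (Suc j) / real n" for j
    by (intro divide_right_mono) auto
  have diff: "real (Suc j) / real n - real j / real n = 1 / real n" for j
    by (simp add: diff_divide_distrib[symmetric])
  have "emeasure lborel (cell n j k) =
      emeasure lborel {real j / real n <.. real (Suc j) / real n} * emeasure lborel {real k / real n <.. real (Suc k) / real n}"
    unfolding cell_def lborel_prod[symmetric] by (rule lborel.emeasure_pair_measure_Times) auto
  also have "\<dots> = ennreal (1 / real n) * ennreal (1 / real n)"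
    by (simp only: emeasure_lborel_Ioc[OF le] diff)
  also have "\<dots> = ennreal (1 / (real n)\<^sup>2)"
    by (subst ennreal_mult[symmetric]) (simp_all add: power2_eq_square)
  finally show ?thesis .
qed

lemma sum_indicator_Ioc:
  "(\<Sum>j'<j. indicator {real j' / real n <.. real (Suc j') / real n} x) = (indicator {0 <.. real j / real n} x :: real)"
proof (induction j)
  case (Suc j)
  have "indicator {0<..a} x + indicator {a<..c} x = (indicator {0<..c} x :: real)" if "0 \<le> a" "a \<le> c" for a c :: real
    using that by (auto split: split_indicator)
  from this[of "real j / real n" "real (Suc j) / real n"] show ?case
    unfolding sum.lessThan_Suc Suc by (simp add: divide_right_mono)
qed simp

lemma sum_indicator_cell:
  "(\<Sum>j'<j. \<Sum>k'<k. indicator (cell n j' k') p) =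
    (indicator ({0 <.. real j / real n} \<times> {0 <.. real k / real n}) p :: real)"
  unfolding cell_def indicator_times sum_product[symmetric] sum_indicator_Ioc ..

lemma cell_subset:
  assumes n: "n > 0" and jk: "j < n" "k < n" and p: "p \<in> cell n j k"
  shows "p \<in> {0..1} \<times> {0..1}"
    and "dist p (real j / real n, real k / real n) \<le> 2 / real n"
proof -
  obtain s t where st: "p = (s, t)" by (cases p)
  have *: "real j / real n < s" "s \<le> real (Suc j) / real n" "real k / real n < t" "t \<le> real (Suc k) / real n"
    using p by (auto simp: st cell_def)
  have "real (Suc j) / real n \<le> 1" "real (Suc k) / real n \<le> 1" "0 \<le> real j / real n" "0 \<le> real k / real n"
    using jk n by (auto simp: divide_le_eq)
  with * have "0 \<le> s" "s \<le> 1" "0 \<le> t" "t \<le> 1" by linarith+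
  then show "p \<in> {0..1} \<times> {0..1}" by (simp add: st)
  have split: "real (Suc i) / real n = real i / real n + 1 / real n" for i
    by (simp add: add_divide_distrib)
  have "dist p (real j / real n, real k / real n) \<le> \<bar>s - real j / real n\<bar> + \<bar>t - real k / real n\<bar>"
    unfolding st dist_Pair_Pair dist_real_def by (rule sqrt_sum_squares_le_sum) auto
  also have "\<dots> \<le> 2 / real n" using * unfolding split by simp
  finally show "dist p (real j / real n, real k / real n) \<le> 2 / real n" .
qed

section \<open>Cell averages of the drift and the discretised integral equation\<close>

locale drift_field =
  fixes b :: "real \<Rightarrow> real \<Rightarrow> real^'d \<Rightarrow> real^'d" and C :: real
  assumes b_meas: "(\<lambda>(s, t, x). b s t x) \<in> borel_measurable borel"
    and b_bound: "\<And>s t x i. \<bar>b s t x $ i\<bar> \<le> C"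
    and b_mono: "\<And>s t x y i. (\<And>i. x $ i \<le> y $ i) \<Longrightarrow> b s t x $ i \<le> b s t y $ i"
begin

text \<open>The factor is the reciprocal of the cell area. Averaging in \<open>(s, t)\<close> at a
  frozen space point preserves the bound and the monotonicity and asks for no regularity in
  \<open>(s, t)\<close>.\<close>

definition cell_mean :: "nat \<Rightarrow> nat \<Rightarrow> nat \<Rightarrow> real^'d \<Rightarrow> real^'d" where
  "cell_mean n j k x = (\<chi> i. (real n)\<^sup>2 * (\<integral>p. indicator (cell n j k) p * b (fst p) (snd p) x $ i \<partial>lborel))"

lemma b_comp_measurable:
  assumes "h \<in> borel_measurable M" "f \<in> borel_measurable M" "x \<in> borel_measurable M"
  shows "(\<lambda>p. b (h p) (f p) (x p) $ i) \<in> borel_measurable M"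
proof -
  have "(\<lambda>p. (h p, f p, x p)) \<in> borel_measurable M"
    using assms by (intro borel_measurable_Pair)
  from measurable_compose[OF measurable_compose[OF this b_meas] borel_measurable_vec_nth]
  show ?thesis by simp
qed

lemma cell_integrable:
  fixes f :: "real \<times> real \<Rightarrow> real"
  assumes f: "f \<in> borel_measurable borel" "\<And>p. \<bar>f p\<bar> \<le> K"
  shows "integrable lborel (\<lambda>p. indicator (cell n j k) p * f p)"
  using integrableI_bounded_set_indicator[of "cell n j k" lborel f K] f
  by (simp add: emeasure_cell)

lemma b_cell_integrable:
  assumes "x \<in> borel_measurable borel"
  shows "integrable lborel (\<lambda>p. indicator (cell n j k) p * b (fst p) (snd p) (x p) $ i)"
proof (rule cell_integrable)
  show "(\<lambda>p. b (fst p) (snd p) (x p) $ i) \<in> borel_measurable borel"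
    using assms by (intro b_comp_measurable) (simp_all add: borel_prod[symmetric])
qed (rule b_bound)

lemma cell_mean_measurable: "cell_mean n j k \<in> borel_measurable borel"
proof (rule borel_measurable_vecI)
  fix i
  have sets_eq: "sets ((borel :: (real^'d) measure) \<Otimes>\<^sub>M (lborel :: (real \<times> real) measure)) = sets (borel \<Otimes>\<^sub>M (borel \<Otimes>\<^sub>M borel))"
    by (rule sets_pair_measure_cong[OF refl]) (simp only: sets_lborel borel_prod)
  have 1: "(\<lambda>q. b (fst (snd q)) (snd (snd q)) (fst q) $ i) \<in> borel_measurable (borel \<Otimes>\<^sub>M (lborel :: (real \<times> real) measure))"
    unfolding measurable_cong_sets[OF sets_eq refl] by (intro b_comp_measurable) measurable
  have 2: "(\<lambda>q. indicator (cell n j k) (snd q) :: real) \<in> borel_measurable (borel \<Otimes>\<^sub>M (lborel :: (real \<times> real) measure))"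
    by measurable
  have "(\<lambda>x. \<integral>p. indicator (cell n j k) p * b (fst p) (snd p) x $ i \<partial>lborel) \<in> borel_measurable borel"
    using borel_measurable_times[OF 2 1]
    by (intro lborel.borel_measurable_lebesgue_integral) (simp add: case_prod_unfold)
  then show "(\<lambda>x. cell_mean n j k x $ i) \<in> borel_measurable borel"
    unfolding cell_mean_def by simp
qed

lemma C_nonneg: "C \<ge> 0"
  using b_bound[of 0 0 0] abs_ge_zero order_trans by blast

lemma cell_mean_bound:
  assumes n: "n > 0"
  shows "\<bar>cell_mean n j k x $ i\<bar> \<le> C"
proof -
  have "\<bar>\<integral>p. indicator (cell n j k) p * b (fst p) (snd p) x $ i \<partial>lborel\<bar>
      \<le> (\<integral>p. \<bar>indicator (cell n j k) p * b (fst p) (snd p) x $ i\<bar> \<partial>lborel)"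
    by (rule integral_abs_bound)
  also have "\<dots> \<le> (\<integral>p. indicator (cell n j k) p * C \<partial>lborel)"
    using b_bound by (intro integral_mono integrable_abs b_cell_integrable cell_integrable[where K=C])
      (auto simp: C_nonneg split: split_indicator)
  also have "\<dots> = C / (real n)\<^sup>2"
    by (simp add: measure_def emeasure_cell)
  finally show ?thesis
    using n by (simp add: cell_mean_def abs_mult field_simps)
qed

lemma cell_mean_mono:
  assumes "\<And>i. x $ i \<le> y $ i"
  shows "cell_mean n j k x $ i \<le> cell_mean n j k y $ i"
  unfolding cell_mean_def vec_lambda_beta
  using b_mono[OF assms]
  by (intro mult_left_mono integral_mono b_cell_integrable) (auto split: split_indicator)

lemma drift_grid_cell_mean: "n > 0 \<Longrightarrow> \<epsilon> \<ge> 0 \<Longrightarrow> drift_grid n C \<epsilon> (cell_mean n)"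
  by unfold_locales (auto intro: cell_mean_measurable cell_mean_bound cell_mean_mono)

text \<open>A statement about a single path \<open>w\<close>; probability enters only when
  \<open>w\<close> is a path of the sheet.\<close>

definition is_solution :: "(real \<Rightarrow> real \<Rightarrow> real^'d) \<Rightarrow> (real \<Rightarrow> real \<Rightarrow> real^'d) \<Rightarrow> bool" where
  "is_solution w u \<longleftrightarrow>
     continuous_on ({0..1} \<times> {0..1}) (\<lambda>(s, t). u s t) \<and>
     (\<forall>r\<in>{0..1}. u 0 r = 0 \<and> u r 0 = 0) \<and>
     (\<forall>s\<in>{0..1}. \<forall>t\<in>{0..1}. u s t = (LINT \<zeta>:{0..t}|lborel. LINT \<xi>:{0..s}|lborel.
        b \<xi> \<zeta> (w \<xi> \<zeta> + u \<xi> \<zeta>) - b \<xi> \<zeta> (w \<xi> \<zeta>)))"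

text \<open>Continuing \<open>w\<close> and \<open>u\<close> by 0 outside the square gives Borel
  functions on the plane; Fubini turns the iterated integral into a planar one, which is cut along
  the cells.\<close>

lemma solution_grid_eq:
  assumes w: "continuous_on ({0..1} \<times> {0..1}) (\<lambda>(s, t). w s t)"
    and u: "is_solution w u" and n: "n > 0" and jk: "j \<le> n" "k \<le> n"
  defines "\<phi> \<equiv> \<lambda>p. indicator ({0..1} \<times> {0..1}) p *\<^sub>R w (fst p) (snd p)"
    and "\<psi> \<equiv> \<lambda>p. indicator ({0..1} \<times> {0..1}) p *\<^sub>R u (fst p) (snd p)"
  shows "\<phi> \<in> borel_measurable borel" "\<psi> \<in> borel_measurable borel"
    and "u (real j / real n) (real k / real n) $ i = (\<Sum>j'<j. \<Sum>k'<k.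
      (\<integral>p. indicator (cell n j' k') p * b (fst p) (snd p) (\<phi> p + \<psi> p) $ i \<partial>lborel)
      - (\<integral>p. indicator (cell n j' k') p * b (fst p) (snd p) (\<phi> p) $ i \<partial>lborel))"
proof -
  let ?s = "real j / real n" and ?t = "real k / real n"
  have st: "?s \<in> {0..1}" "?t \<in> {0..1}" using jk n by (simp_all add: divide_le_eq)
  have sq: "({0..1} \<times> {0..1} :: (real \<times> real) set) \<in> sets borel"
    unfolding borel_prod[symmetric] by measurable
  show \<phi>m: "\<phi> \<in> borel_measurable borel"
    unfolding \<phi>_def using borel_measurable_continuous_on_indicator[OF sq w] by (simp add: case_prod_unfold)
  show \<psi>m: "\<psi> \<in> borel_measurable borel"
    unfolding \<psi>_def using borel_measurable_continuous_on_indicator[OF sq conjunct1[OF u[unfolded is_solution_def]]]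
    by (simp add: case_prod_unfold)
  define g where "g p = b (fst p) (snd p) (\<phi> p + \<psi> p) - b (fst p) (snd p) (\<phi> p)" for p
  have gi: "(\<lambda>p. g p $ i) \<in> borel_measurable borel" for i
    unfolding g_def vector_minus_component using \<phi>m \<psi>m
    by (intro borel_measurable_diff b_comp_measurable borel_measurable_add) (simp_all add: borel_prod[symmetric])
  then have g: "g \<in> borel_measurable borel" by (rule borel_measurable_vecI)
  have g_bd: "norm (g p) \<le> real CARD('d) * (2 * C)" for p
  proof -
    have "norm (g p) \<le> (\<Sum>i\<in>UNIV. \<bar>g p $ i\<bar>)" by (rule norm_le_l1_cart)
    also have "\<dots> \<le> (\<Sum>i\<in>(UNIV::'d set). 2 * C)"
    proof (rule sum_mono)
      fix i
      show "\<bar>g p $ i\<bar> \<le> 2 * C"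
        using b_bound[of "fst p" "snd p" "\<phi> p + \<psi> p" i] b_bound[of "fst p" "snd p" "\<phi> p" i]
        unfolding g_def by simp
    qed
    finally show ?thesis by simp
  qed
  let ?R = "{0..?s} \<times> {0..?t}"
  have R: "?R \<in> sets lborel" "emeasure lborel ?R < \<infinity>"
  proof -
    have c: "compact ?R" by (intro compact_Times) auto
    show "?R \<in> sets lborel" using borel_compact[OF c] by simp
    show "emeasure lborel ?R < \<infinity>" using emeasure_bounded_finite[OF compact_imp_bounded[OF c]] by simp
  qed
  have int: "integrable lborel (\<lambda>p. indicator ?R p *\<^sub>R g p)"
    by (rule integrableI_bounded_set_indicator[where B="real CARD('d) * (2 * C)"]) (use R g g_bd in auto)
  have "u ?s ?t = (LINT \<zeta>:{0..?t}|lborel. LINT \<xi>:{0..?s}|lborel.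
        b \<xi> \<zeta> (w \<xi> \<zeta> + u \<xi> \<zeta>) - b \<xi> \<zeta> (w \<xi> \<zeta>))"
    using u st unfolding is_solution_def by blast
  also have "\<dots> = (\<integral>\<zeta>. \<integral>\<xi>. indicator ?R (\<xi>, \<zeta>) *\<^sub>R g (\<xi>, \<zeta>) \<partial>lborel \<partial>lborel)"
    unfolding set_lebesgue_integral_def
  proof (intro Bochner_Integration.integral_cong refl)
    fix \<zeta> :: real
    have "indicator {0..?t} \<zeta> *\<^sub>R (\<integral>\<xi>. indicator {0..?s} \<xi> *\<^sub>R (b \<xi> \<zeta> (w \<xi> \<zeta> + u \<xi> \<zeta>) - b \<xi> \<zeta> (w \<xi> \<zeta>)) \<partial>lborel)
      = (\<integral>\<xi>. indicator {0..?t} \<zeta> *\<^sub>R (indicator {0..?s} \<xi> *\<^sub>R (b \<xi> \<zeta> (w \<xi> \<zeta> + u \<xi> \<zeta>) - b \<xi> \<zeta> (w \<xi> \<zeta>))) \<partial>lborel)"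
      by (rule integral_scaleR_right[symmetric])
    also have "\<dots> = (\<integral>\<xi>. indicator ?R (\<xi>, \<zeta>) *\<^sub>R g (\<xi>, \<zeta>) \<partial>lborel)"
      using st by (intro Bochner_Integration.integral_cong refl)
        (auto simp: g_def \<phi>_def \<psi>_def split: split_indicator)
    finally show "indicator {0..?t} \<zeta> *\<^sub>R (\<integral>\<xi>. indicator {0..?s} \<xi> *\<^sub>R (b \<xi> \<zeta> (w \<xi> \<zeta> + u \<xi> \<zeta>) - b \<xi> \<zeta> (w \<xi> \<zeta>)) \<partial>lborel)
      = (\<integral>\<xi>. indicator ?R (\<xi>, \<zeta>) *\<^sub>R g (\<xi>, \<zeta>) \<partial>lborel)" .
  qed
  also have "\<dots> = (\<integral>p. indicator ?R p *\<^sub>R g p \<partial>lborel)"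
    using lborel_pair.integral_snd[of "\<lambda>\<xi> \<zeta>. indicator ?R (\<xi>, \<zeta>) *\<^sub>R g (\<xi>, \<zeta>)"] int
    by (simp add: lborel_prod case_prod_unfold)
  finally have "u ?s ?t $ i = (\<integral>p. (indicator ?R p *\<^sub>R g p) $ i \<partial>lborel)"
    using integral_bounded_linear[OF bounded_linear_vec_nth int, of i] by simp
  also have "\<dots> = (\<integral>p. (\<Sum>j'<j. \<Sum>k'<k. indicator (cell n j' k') p * g p $ i) \<partial>lborel)"
  proof (intro Bochner_Integration.integral_cong refl)
    fix p :: "real \<times> real"
    obtain x y where p: "p = (x, y)" by (cases p)
    \<comment> \<open>The closed rectangle and the union of the cells differ only on the axes; there
      \<open>u = 0\<close> makes the integrand exactly 0.\<close>
    have zero: "g p = 0" if "p \<in> ?R" "x = 0 \<or> y = 0"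
    proof -
      have "u x y = 0" using u that st unfolding is_solution_def p by auto
      then show ?thesis by (simp add: g_def \<psi>_def p)
    qed
    have "(indicator ?R p *\<^sub>R g p) $ i = indicator ({0 <.. ?s} \<times> {0 <.. ?t}) p * g p $ i"
      using zero by (cases "x = 0 \<or> y = 0"; cases "p \<in> ?R") (auto simp: p indicator_def)
    then show "(indicator ?R p *\<^sub>R g p) $ i = (\<Sum>j'<j. \<Sum>k'<k. indicator (cell n j' k') p * g p $ i)"
      unfolding sum_indicator_cell[symmetric] sum_distrib_right .
  qed
  also have "\<dots> = (\<Sum>j'<j. \<Sum>k'<k. \<integral>p. indicator (cell n j' k') p * g p $ i \<partial>lborel)"
  proof -
    have "integrable lborel (\<lambda>p. indicator (cell n j' k') p * g p $ i)" for j' k'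
    proof (rule cell_integrable[OF gi])
      show "\<bar>g p $ i\<bar> \<le> real CARD('d) * (2 * C)" for p
        using component_le_norm_cart[of "g p" i] g_bd[of p] by linarith
    qed
    note int_cell = this
    have "(\<integral>p. (\<Sum>j'<j. \<Sum>k'<k. indicator (cell n j' k') p * g p $ i) \<partial>lborel)
        = (\<Sum>j'<j. \<integral>p. (\<Sum>k'<k. indicator (cell n j' k') p * g p $ i) \<partial>lborel)"
      by (intro Bochner_Integration.integral_sum Bochner_Integration.integrable_sum int_cell)
    also have "\<dots> = (\<Sum>j'<j. \<Sum>k'<k. \<integral>p. indicator (cell n j' k') p * g p $ i \<partial>lborel)"
      by (intro sum.cong refl Bochner_Integration.integral_sum int_cell)
    finally show ?thesis .
  qed
  also have "\<dots> = (\<Sum>j'<j. \<Sum>k'<k.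
      (\<integral>p. indicator (cell n j' k') p * b (fst p) (snd p) (\<phi> p + \<psi> p) $ i \<partial>lborel)
      - (\<integral>p. indicator (cell n j' k') p * b (fst p) (snd p) (\<phi> p) $ i \<partial>lborel))"
    unfolding g_def vector_minus_component right_diff_distrib using \<phi>m \<psi>m
    by (intro sum.cong refl Bochner_Integration.integral_diff b_cell_integrable borel_measurable_add)
  finally show "u ?s ?t $ i = \<dots>" .
qed

text \<open>Monotonicity replaces regularity: inside a cell \<open>w + u\<close> is at most its
  corner value plus \<epsilon>, hence at most \<open>X + \<epsilon>\<close> by the induction
  hypothesis, while \<open>w\<close> is at least its corner value minus \<epsilon>. The threshold
  \<open>n0\<close> precedes \<open>X\<close>: it depends only on \<epsilon> and the moduli of
  continuity of \<open>w\<close> and \<open>u\<close>.\<close>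

lemma solution_le_scheme:
  assumes w: "continuous_on ({0..1} \<times> {0..1}) (\<lambda>(s, t). w s t)"
    and u: "is_solution w u" and \<epsilon>: "\<epsilon> > 0"
  shows "\<exists>n0>0. \<forall>n\<ge>n0. \<forall>X.
    (\<forall>j\<le>n. \<forall>k\<le>n. \<forall>i. X j k $ i = w (real j / real n) (real k / real n) $ i + 1 / (real n)\<^sup>2 *
        (\<Sum>j'<j. \<Sum>k'<k. cell_mean n j' k' (X j' k' + vec \<epsilon>) $ i
           - cell_mean n j' k' (w (real j' / real n) (real k' / real n) + vec (- \<epsilon>)) $ i)) \<longrightarrow>
    (\<forall>j\<le>n. \<forall>k\<le>n. \<forall>i. w (real j / real n) (real k / real n) $ i + u (real j / real n) (real k / real n) $ i \<le> X j k $ i)"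
proof -
  let ?sq = "{0..1} \<times> {0..1} :: (real \<times> real) set"
  have sq: "compact ?sq" by (intro compact_Times) auto
  have cont_u: "continuous_on ?sq (\<lambda>(s, t). u s t)" using u unfolding is_solution_def by blast
  obtain d1 where d1: "d1 > 0" "\<And>p q. p \<in> ?sq \<Longrightarrow> q \<in> ?sq \<Longrightarrow> dist p q < d1 \<Longrightarrow>
      dist (case p of (s, t) \<Rightarrow> w s t) (case q of (s, t) \<Rightarrow> w s t) < \<epsilon> / 2"
    using compact_uniformly_continuous[OF w sq] half_gt_zero[OF \<epsilon>] unfolding uniformly_continuous_on_def by metis
  obtain d2 where d2: "d2 > 0" "\<And>p q. p \<in> ?sq \<Longrightarrow> q \<in> ?sq \<Longrightarrow> dist p q < d2 \<Longrightarrow>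
      dist (case p of (s, t) \<Rightarrow> u s t) (case q of (s, t) \<Rightarrow> u s t) < \<epsilon> / 2"
    using compact_uniformly_continuous[OF cont_u sq] half_gt_zero[OF \<epsilon>] unfolding uniformly_continuous_on_def by metis
  \<comment> \<open>Every point of a cell is within \<open>2 / n\<close> of its lower left
    corner.\<close>
  obtain n0 where n0: "real n0 > 2 / min d1 d2" using reals_Archimedean2 by blast
  have n0_pos: "n0 > 0" using n0 d1(1) d2(1) by (intro gr0I) auto
  show ?thesis
  proof (intro exI[of _ n0] conjI allI impI n0_pos)
    fix n X j k i
    assume "n0 \<le> n"
      and X: "\<forall>j\<le>n. \<forall>k\<le>n. \<forall>i. X j k $ i = w (real j / real n) (real k / real n) $ i + 1 / (real n)\<^sup>2 *
        (\<Sum>j'<j. \<Sum>k'<k. cell_mean n j' k' (X j' k' + vec \<epsilon>) $ i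
           - cell_mean n j' k' (w (real j' / real n) (real k' / real n) + vec (- \<epsilon>)) $ i)"
      and "j \<le> n" "k \<le> n"
    then have n: "n > 0" using n0_pos by simp
    have "2 / min d1 d2 < real n" using n0 \<open>n0 \<le> n\<close> by linarith
    then have fine: "2 / real n < min d1 d2"
    proof -
      have "min d1 d2 > 0" "real n > 0" using n d1(1) d2(1) by simp_all
      with \<open>2 / min d1 d2 < real n\<close> show ?thesis
        by (simp only: pos_divide_less_eq mult.commute[of "real n"])
    qed
    show "w (real j / real n) (real k / real n) $ i + u (real j / real n) (real k / real n) $ i \<le> X j k $ i"
      using \<open>j \<le> n\<close> \<open>k \<le> n\<close>
    proof (induction j arbitrary: k i rule: less_induct)
      case (less j)
      define \<phi> where "\<phi> p = indicator ?sq p *\<^sub>R w (fst p) (snd p)" for p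
      define \<psi> where "\<psi> p = indicator ?sq p *\<^sub>R u (fst p) (snd p)" for p
      note eq = solution_grid_eq[OF w u n less.prems, folded \<phi>_def \<psi>_def]
      have cell_le: "(\<integral>p. indicator (cell n j' k') p * b (fst p) (snd p) (\<phi> p + \<psi> p) $ i \<partial>lborel)
          - (\<integral>p. indicator (cell n j' k') p * b (fst p) (snd p) (\<phi> p) $ i \<partial>lborel)
        \<le> 1 / (real n)\<^sup>2 * (cell_mean n j' k' (X j' k' + vec \<epsilon>) $ i
           - cell_mean n j' k' (w (real j' / real n) (real k' / real n) + vec (- \<epsilon>)) $ i)"
        if j': "j' < j" and k': "k' < k" for j' k'
      proof -
        let ?c = "(real j' / real n, real k' / real n)"
        have jk': "j' < n" "k' < n" using that less.prems by auto
        have c_sq: "?c \<in> ?sq" using jk' n by (simp add: divide_le_eq)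
        have near: "\<phi> p $ l + \<psi> p $ l \<le> X j' k' $ l + \<epsilon>" "w (fst ?c) (snd ?c) $ l - \<epsilon> \<le> \<phi> p $ l"
          if p: "p \<in> cell n j' k'" for p l
        proof -
          note p' = cell_subset[OF n jk' p]
          have "dist (\<phi> p) (w (fst ?c) (snd ?c)) < \<epsilon> / 2"
            using d1(2)[OF p'(1) c_sq] p' fine by (simp add: \<phi>_def case_prod_unfold)
          then have 1: "\<bar>\<phi> p $ l - w (fst ?c) (snd ?c) $ l\<bar> < \<epsilon> / 2"
            using component_le_norm_cart[of "\<phi> p - w (fst ?c) (snd ?c)" l] by (simp add: dist_norm)
          have "dist (\<psi> p) (u (fst ?c) (snd ?c)) < \<epsilon> / 2"
            using d2(2)[OF p'(1) c_sq] p' fine by (simp add: \<psi>_def case_prod_unfold)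
          then have 2: "\<bar>\<psi> p $ l - u (fst ?c) (snd ?c) $ l\<bar> < \<epsilon> / 2"
            using component_le_norm_cart[of "\<psi> p - u (fst ?c) (snd ?c)" l] by (simp add: dist_norm)
          have 3: "w (fst ?c) (snd ?c) $ l + u (fst ?c) (snd ?c) $ l \<le> X j' k' $ l"
            using less.IH[OF j', of k' l] jk' by simp
          show "\<phi> p $ l + \<psi> p $ l \<le> X j' k' $ l + \<epsilon>" "w (fst ?c) (snd ?c) $ l - \<epsilon> \<le> \<phi> p $ l"
            using 1 2 3 by linarith+
        qed
        have "(\<integral>p. indicator (cell n j' k') p * b (fst p) (snd p) (\<phi> p + \<psi> p) $ i \<partial>lborel)
          \<le> (\<integral>p. indicator (cell n j' k') p * b (fst p) (snd p) (X j' k' + vec \<epsilon>) $ i \<partial>lborel)"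
          using near(1) eq(1,2)
          by (intro integral_mono b_cell_integrable borel_measurable_add)
             (auto split: split_indicator intro!: b_mono)
        moreover have "(\<integral>p. indicator (cell n j' k') p * b (fst p) (snd p) (w (fst ?c) (snd ?c) + vec (- \<epsilon>)) $ i \<partial>lborel)
          \<le> (\<integral>p. indicator (cell n j' k') p * b (fst p) (snd p) (\<phi> p) $ i \<partial>lborel)"
          using near(2) eq(1)
          by (intro integral_mono b_cell_integrable) (auto split: split_indicator intro!: b_mono)
        ultimately show ?thesis
          using n by (simp add: cell_mean_def right_diff_distrib)
      qed
      have "u (real j / real n) (real k / real n) $ i \<le> (\<Sum>j'<j. \<Sum>k'<k. 1 / (real n)\<^sup>2 * (cell_mean n j' k' (X j' k' + vec \<epsilon>) $ i
           - cell_mean n j' k' (w (real j' / real n) (real k' / real n) + vec (- \<epsilon>)) $ i))"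
        unfolding eq(3) by (intro sum_mono cell_le) auto
      then show ?case
        using X less.prems by (simp add: sum_distrib_left)
    qed
  qed
qed

end

section \<open>Almost sure uniqueness\<close>

text \<open>The rectangular increments telescope in each index, and the boundary terms vanish
  because \<open>W\<close> is 0 on the axes.\<close>

lemma walk_grid_incr:
  fixes W :: "real \<Rightarrow> real \<Rightarrow> 'a \<Rightarrow> real^'d"
  assumes W: "brownian_sheet M F W" and \<omega>: "\<omega> \<in> space M" and n: "n > 0" and jk: "j \<le> n" "k \<le> n"
  shows "walk (grid_incr W n \<omega>) j k = W (real j / real n) (real k / real n) \<omega>"
proof -
  have "walk (grid_incr W n \<omega>) j k $ i = W (real j / real n) (real k / real n) \<omega> $ i" for i
  proof -
    define Z where "Z j k = W (real j / real n) (real k / real n) \<omega> $ i" for j k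
    have axes: "Z 0 k = 0" "Z j 0 = 0" if "j \<le> n" "k \<le> n" for j k
      using brownian_sheetD(5)[OF W \<omega>] grid_point[OF n] that unfolding Z_def by simp_all
    have "walk (grid_incr W n \<omega>) j k $ i
        = (\<Sum>j'<j. \<Sum>k'<k. (Z (Suc j') (Suc k') - Z j' (Suc k')) - (Z (Suc j') k' - Z j' k'))"
      unfolding walk_def vec_lambda_beta using jk
      by (intro sum.cong refl) (auto simp: grid_incr_def rect_incr_def Z_def)
    also have "\<dots> = (\<Sum>j'<j. (Z (Suc j') k - Z (Suc j') 0) - (Z j' k - Z j' 0))"
    proof (rule sum.cong[OF refl])
      fix j'
      show "(\<Sum>k'<k. (Z (Suc j') (Suc k') - Z j' (Suc k')) - (Z (Suc j') k' - Z j' k'))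
          = (Z (Suc j') k - Z (Suc j') 0) - (Z j' k - Z j' 0)"
        using sum_lessThan_telescope[of "\<lambda>k'. Z (Suc j') k' - Z j' k'" k] by (simp add: algebra_simps)
    qed
    also have "\<dots> = (Z j k - Z j 0) - (Z 0 k - Z 0 0)"
      using sum_lessThan_telescope[of "\<lambda>j'. Z j' k - Z j' 0" j] by simp
    also have "\<dots> = Z j k" using axes jk by simp
    finally show ?thesis unfolding Z_def .
  qed
  then show ?thesis by (simp add: vec_eq_iff)
qed

text \<open>The grids run through multiples of \<open>q\<close>, along which a point with
  denominator \<open>q\<close> stays on the grid. In the limit only the contribution of the axis
  cells disappears.\<close>

lemma scheme_gap_tendsto:
  assumes "q > 0"
  shows "(\<lambda>l. scheme_gap d C (q * Suc l) \<epsilon>) \<longlonglongrightarrow> exp (d * C\<^sup>2) *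
     (2 * sqrt (2 * sqrt (exp (d * C\<^sup>2) * (2 * C * (d * (16 * C * \<epsilon> * sqrt d))) / 8)))"
proof -
  have "(\<lambda>l. 4 * C / real q * inverse (real (Suc l)) + 16 * C * \<epsilon> * sqrt d) \<longlonglongrightarrow> 4 * C / real q * 0 + 16 * C * \<epsilon> * sqrt d"
    by (intro tendsto_intros LIMSEQ_inverse_real_of_nat)
  moreover have "4 * C / real q * inverse (real (Suc l)) = 4 * C / real (q * Suc l)" for l
    by (simp only: divide_inverse of_nat_mult inverse_mult_distrib mult.assoc)
  ultimately have "(\<lambda>l. 4 * C / real (q * Suc l) + 16 * C * \<epsilon> * sqrt d) \<longlonglongrightarrow> 16 * C * \<epsilon> * sqrt d"
    by simp
  then show ?thesis
    unfolding scheme_gap_def by (intro tendsto_intros) simp_all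
qed

section \<open>Limit of the schemes and the sign of solutions\<close>

context drift_field
begin

text \<open>What is used of the scheme once it lives on \<open>M\<close>. Measurability is included
  because the process is later picked by choice, so that nothing else is known about it.\<close>

definition dominating_process ::
  "'a measure \<Rightarrow> (real \<Rightarrow> real \<Rightarrow> 'a \<Rightarrow> real^'d) \<Rightarrow> nat \<Rightarrow> real \<Rightarrow> ('a \<Rightarrow> nat \<Rightarrow> nat \<Rightarrow> real^'d) \<Rightarrow> bool" where
  "dominating_process M W n \<epsilon> X \<longleftrightarrow>
     (\<forall>\<omega>\<in>space M. \<forall>j\<le>n. \<forall>k\<le>n. \<forall>i.
        X \<omega> j k $ i = W (real j / real n) (real k / real n) \<omega> $ i + 1 / (real n)\<^sup>2 *
        (\<Sum>j'<j. \<Sum>k'<k. cell_mean n j' k' (X \<omega> j' k' + vec \<epsilon>) $ i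
           - cell_mean n j' k' (W (real j' / real n) (real k' / real n) \<omega> + vec (- \<epsilon>)) $ i)) \<and>
     (\<forall>\<omega>\<in>space M. \<forall>j\<le>n. \<forall>k\<le>n. \<forall>i. W (real j / real n) (real k / real n) \<omega> $ i \<le> X \<omega> j k $ i) \<and>
     (\<forall>j\<le>n. \<forall>k\<le>n. \<forall>i. \<forall>g. mono g \<longrightarrow> (\<forall>x. 0 \<le> g x \<and> g x \<le> (1::real)) \<longrightarrow> g \<in> borel_measurable borel \<longrightarrow>
        (\<lambda>\<omega>. g (X \<omega> j k $ i) - g (W (real j / real n) (real k / real n) \<omega> $ i)) \<in> borel_measurable M \<and>
        (\<integral>\<omega>. g (X \<omega> j k $ i) - g (W (real j / real n) (real k / real n) \<omega> $ i) \<partial>M)\<^sup>2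
          \<le> scheme_gap (real CARD('d)) C n \<epsilon>)"

lemma
  assumes "dominating_process M W n \<epsilon> X" and jk: "j \<le> n" "k \<le> n"
  shows dominating_process_eq: "\<omega> \<in> space M \<Longrightarrow>
        X \<omega> j k $ i = W (real j / real n) (real k / real n) \<omega> $ i + 1 / (real n)\<^sup>2 *
        (\<Sum>j'<j. \<Sum>k'<k. cell_mean n j' k' (X \<omega> j' k' + vec \<epsilon>) $ i
           - cell_mean n j' k' (W (real j' / real n) (real k' / real n) \<omega> + vec (- \<epsilon>)) $ i)"
    and dominating_process_ge: "\<omega> \<in> space M \<Longrightarrow> W (real j / real n) (real k / real n) \<omega> $ i \<le> X \<omega> j k $ i"
    and dominating_process_gap: "mono g \<Longrightarrow> (\<And>x. 0 \<le> g x \<and> g x \<le> 1) \<Longrightarrow> g \<in> borel_measurable borel \<Longrightarrow>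
        (\<lambda>\<omega>. g (X \<omega> j k $ i) - g (W (real j / real n) (real k / real n) \<omega> $ i)) \<in> borel_measurable M \<and>
        (\<integral>\<omega>. g (X \<omega> j k $ i) - g (W (real j / real n) (real k / real n) \<omega> $ i) \<partial>M)\<^sup>2
          \<le> scheme_gap (real CARD('d)) C n \<epsilon>"
proof -
  note D = assms(1)[unfolded dominating_process_def]
  show "\<omega> \<in> space M \<Longrightarrow>
        X \<omega> j k $ i = W (real j / real n) (real k / real n) \<omega> $ i + 1 / (real n)\<^sup>2 *
        (\<Sum>j'<j. \<Sum>k'<k. cell_mean n j' k' (X \<omega> j' k' + vec \<epsilon>) $ i
           - cell_mean n j' k' (W (real j' / real n) (real k' / real n) \<omega> + vec (- \<epsilon>)) $ i)"
    by (rule D[THEN conjunct1, rule_format, OF _ jk])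
  show "\<omega> \<in> space M \<Longrightarrow> W (real j / real n) (real k / real n) \<omega> $ i \<le> X \<omega> j k $ i"
    by (rule D[THEN conjunct2, THEN conjunct1, rule_format, OF _ jk])
  show "mono g \<Longrightarrow> (\<And>x. 0 \<le> g x \<and> g x \<le> 1) \<Longrightarrow> g \<in> borel_measurable borel \<Longrightarrow>
        (\<lambda>\<omega>. g (X \<omega> j k $ i) - g (W (real j / real n) (real k / real n) \<omega> $ i)) \<in> borel_measurable M \<and>
        (\<integral>\<omega>. g (X \<omega> j k $ i) - g (W (real j / real n) (real k / real n) \<omega> $ i) \<partial>M)\<^sup>2
          \<le> scheme_gap (real CARD('d)) C n \<epsilon>"
    using D[THEN conjunct2, THEN conjunct2] jk by simp
qed

text \<open>The process is the walk of \<open>\<Phi>\<close> applied to the grid increments; their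
  law is \<open>G\<close>, so the expectations computed there transfer.\<close>

lemma dominating_process_ex:
  fixes W :: "real \<Rightarrow> real \<Rightarrow> 'a \<Rightarrow> real^'d"
  assumes W: "brownian_sheet M F W" and n: "n > 0" and \<epsilon>: "\<epsilon> \<ge> 0"
  shows "\<exists>X. dominating_process M W n \<epsilon> X"
proof -
  interpret drift_grid n C \<epsilon> "cell_mean n" by (rule drift_grid_cell_mean[OF n \<epsilon>])
  obtain \<Phi> where \<Phi>: "\<Phi> \<in> P \<rightarrow>\<^sub>M P"
    and eq: "\<forall>y\<in>space P. \<forall>j\<le>n. \<forall>k\<le>n. \<forall>i. walk (\<Phi> y) j k $ i = walk y j k $ i + 1 / (real n)\<^sup>2 *
        (\<Sum>j'<j. \<Sum>k'<k. cell_mean n j' k' (walk (\<Phi> y) j' k' + vec \<epsilon>) $ i - cell_mean n j' k' (walk y j' k' + vec (- \<epsilon>)) $ i)"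
    and le: "\<forall>y\<in>space P. \<forall>j\<le>n. \<forall>k\<le>n. \<forall>i. walk y j k $ i \<le> walk (\<Phi> y) j k $ i"
    and est: "\<forall>j\<le>n. \<forall>k\<le>n. \<forall>i. \<forall>g. mono g \<longrightarrow> (\<forall>x. 0 \<le> g x \<and> g x \<le> (1::real)) \<longrightarrow> g \<in> borel_measurable borel \<longrightarrow>
        (\<integral>y. g (walk (\<Phi> y) j k $ i) - g (walk y j k $ i) \<partial>G)\<^sup>2 \<le> scheme_gap (real CARD('d)) C n \<epsilon>"
    using dominating_scheme_ex by (elim bexE conjE)
  note law = distr_grid_incr[OF W n]
  have y: "grid_incr W n \<omega> \<in> space P" if "\<omega> \<in> space M" for \<omega>
    using measurable_space[OF law(1) that] .
  note walk_W = walk_grid_incr[OF W _ n]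
  let ?X = "\<lambda>\<omega>. walk (\<Phi> (grid_incr W n \<omega>))"
  show ?thesis
    unfolding dominating_process_def
  proof (intro exI[of _ ?X] conjI ballI allI impI)
    fix \<omega> j k i assume \<omega>: "\<omega> \<in> space M" and jk: "j \<le> n" "k \<le> n"
    have "?X \<omega> j k $ i = walk (grid_incr W n \<omega>) j k $ i + 1 / (real n)\<^sup>2 *
        (\<Sum>j'<j. \<Sum>k'<k. cell_mean n j' k' (?X \<omega> j' k' + vec \<epsilon>) $ i
           - cell_mean n j' k' (walk (grid_incr W n \<omega>) j' k' + vec (- \<epsilon>)) $ i)"
      using eq y[OF \<omega>] jk by blast
    also have "(\<Sum>j'<j. \<Sum>k'<k. cell_mean n j' k' (?X \<omega> j' k' + vec \<epsilon>) $ i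
           - cell_mean n j' k' (walk (grid_incr W n \<omega>) j' k' + vec (- \<epsilon>)) $ i) =
        (\<Sum>j'<j. \<Sum>k'<k. cell_mean n j' k' (?X \<omega> j' k' + vec \<epsilon>) $ i
           - cell_mean n j' k' (W (real j' / real n) (real k' / real n) \<omega> + vec (- \<epsilon>)) $ i)"
      using jk by (intro sum.cong refl) (simp add: walk_W[OF \<omega>])
    finally show "?X \<omega> j k $ i = W (real j / real n) (real k / real n) \<omega> $ i + 1 / (real n)\<^sup>2 *
        (\<Sum>j'<j. \<Sum>k'<k. cell_mean n j' k' (?X \<omega> j' k' + vec \<epsilon>) $ i
           - cell_mean n j' k' (W (real j' / real n) (real k' / real n) \<omega> + vec (- \<epsilon>)) $ i)"
      unfolding walk_W[OF \<omega> jk] .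
    show "W (real j / real n) (real k / real n) \<omega> $ i \<le> ?X \<omega> j k $ i"
      using le y[OF \<omega>] jk unfolding walk_W[OF \<omega> jk, symmetric] by blast
  next
    fix j k i and g :: "real \<Rightarrow> real"
    assume jk: "j \<le> n" "k \<le> n" and g: "mono g" "\<forall>x. 0 \<le> g x \<and> g x \<le> 1" and gm: "g \<in> borel_measurable borel"
    let ?D = "\<lambda>y. g (walk (\<Phi> y) j k $ i) - g (walk y j k $ i)"
    have wm: "(\<lambda>y. g (walk y j k $ i)) \<in> borel_measurable P"
      using jk by (intro measurable_compose[OF measurable_compose[OF _ borel_measurable_vec_nth] gm] walk_measurable) auto
    have Dm: "?D \<in> borel_measurable P"
      by (intro borel_measurable_diff wm measurable_compose[OF \<Phi> wm])
    have D_eq: "g (?X \<omega> j k $ i) - g (W (real j / real n) (real k / real n) \<omega> $ i) = ?D (grid_incr W n \<omega>)" if "\<omega> \<in> space M" for \<omega>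
      by (simp add: walk_W[OF that jk])
    show "(\<lambda>\<omega>. g (?X \<omega> j k $ i) - g (W (real j / real n) (real k / real n) \<omega> $ i)) \<in> borel_measurable M"
      using measurable_compose[OF law(1) Dm] by (simp only: D_eq cong: measurable_cong)
    have "(\<integral>\<omega>. g (?X \<omega> j k $ i) - g (W (real j / real n) (real k / real n) \<omega> $ i) \<partial>M) = (\<integral>\<omega>. ?D (grid_incr W n \<omega>) \<partial>M)"
      by (intro Bochner_Integration.integral_cong refl D_eq)
    also have "\<dots> = (\<integral>y. ?D y \<partial>distr M P (grid_incr W n))"
      by (rule integral_distr[OF law(1) Dm, symmetric])
    also have "distr M P (grid_incr W n) = G"
      unfolding G_def by (rule law(2))
    finally show "(\<integral>\<omega>. g (?X \<omega> j k $ i) - g (W (real j / real n) (real k / real n) \<omega> $ i) \<partial>M)\<^sup>2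
        \<le> scheme_gap (real CARD('d)) C n \<epsilon>"
      using est jk g gm by simp
  qed
qed

text \<open>The random variable \<open>Y\<close> in the proof bounds \<open>g (w + u) - g w\<close>
  for every solution \<open>u\<close>, yet is defined without reference to \<open>u\<close>. It has
  mean 0, so the exceptional set \<open>Y \<noteq> 0\<close> is common to all solutions.\<close>

lemma AE_solution_nonpos_rational:
  fixes W :: "real \<Rightarrow> real \<Rightarrow> 'a \<Rightarrow> real^'d"
  assumes W: "brownian_sheet M F W" and q: "q > 0" and ac: "a \<le> q" "c \<le> q"
  shows "AE \<omega> in M. \<forall>u. is_solution (\<lambda>s t. W s t \<omega>) u \<longrightarrow> u (real a / real q) (real c / real q) $ i \<le> 0"
proof -
  interpret M: prob_space M by (rule brownian_sheetD(1)[OF W])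
  \<comment> \<open>A strictly increasing test function with values in [0, 1]: boundedness makes the
    comparison of laws applicable, strictness gives \<open>u \<le> 0\<close> in the end.\<close>
  define g :: "real \<Rightarrow> real" where "g x = 1 / 2 + arctan x / pi" for x
  have g: "mono g" "\<And>x. 0 \<le> g x" "\<And>x. g x \<le> 1" "g \<in> borel_measurable borel"
  proof -
    show "mono g" unfolding g_def by (intro monoI) (auto intro!: divide_right_mono simp: arctan_le_iff)
    show "0 \<le> g x" "g x \<le> 1" for x
      using arctan_lbound[of x] arctan_ubound[of x] unfolding g_def by (auto simp: field_simps)
    show "g \<in> borel_measurable borel" unfolding g_def
      by (intro borel_measurable_continuous_onI continuous_intros) simp
  qed
  then have g01: "0 \<le> g x \<and> g x \<le> 1" for x by simp
  let ?w = "\<lambda>\<omega>. W (real a / real q) (real c / real q) \<omega> $ i"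
  let ?n = "\<lambda>l. q * Suc l" and ?e = "\<lambda>m. inverse (real (Suc m))"
  define X where "X m l = (SOME X. dominating_process M W (?n l) (?e m) X)" for m l
  have X: "dominating_process M W (?n l) (?e m) (X m l)" for m l
    unfolding X_def
    by (rule someI_ex[of "dominating_process M W (?n l) (?e m)", OF dominating_process_ex[OF W]]) (use q in simp_all)
  \<comment> \<open>The indices of the fixed point \<open>(a / q, c / q)\<close> on the grid with
    \<open>q * Suc l\<close> steps.\<close>
  let ?j = "\<lambda>l. a * Suc l" and ?k = "\<lambda>l. c * Suc l"
  have jk: "?j l \<le> ?n l" "?k l \<le> ?n l" for l using ac by (auto intro: mult_right_mono simp del: mult_Suc_right)
  have frac: "real (?j l) / real (?n l) = real a / real q" "real (?k l) / real (?n l) = real c / real q" for l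
    by (simp_all only: of_nat_mult) simp_all
  define D where "D m l \<omega> = g (X m l \<omega> (?j l) (?k l) $ i) - g (?w \<omega>)" for m l \<omega>
  have D_meas: "D m l \<in> borel_measurable M"
    and D_int: "(\<integral>\<omega>. D m l \<omega> \<partial>M)\<^sup>2 \<le> scheme_gap (real CARD('d)) C (?n l) (?e m)" for m l
    using dominating_process_gap[OF X[of l m] jk[of l] g(1) g01 g(4), of i]
    unfolding D_def frac by auto
  have D_ge: "0 \<le> D m l \<omega>" if "\<omega> \<in> space M" for m l \<omega>
    using dominating_process_ge[OF X[of l m] jk[of l] that, of i] monoD[OF g(1)]
    unfolding D_def frac by simp
  have D_le: "D m l \<omega> \<le> 1" for m l \<omega>
    using g(2)[of "?w \<omega>"] g(3)[of "X m l \<omega> (?j l) (?k l) $ i"] unfolding D_def by simp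
  have D_nn: "(\<integral>\<^sup>+\<omega>. ennreal (D m l \<omega>) \<partial>M) \<le> ennreal (sqrt (scheme_gap (real CARD('d)) C (?n l) (?e m)))" for m l
  proof -
    have "integrable M (D m l)"
      using D_ge D_le D_meas by (intro M.integrable_const_bound[where B=1] AE_I2) auto
    then have "(\<integral>\<^sup>+\<omega>. ennreal (D m l \<omega>) \<partial>M) = ennreal (\<integral>\<omega>. D m l \<omega> \<partial>M)"
      using D_ge by (intro nn_integral_eq_integral AE_I2) auto
    then show ?thesis
      using real_le_rsqrt[OF D_int[of m l]] by (simp add: ennreal_leI)
  qed
  define h where "h x = exp (real CARD('d) * C\<^sup>2) *
     (2 * sqrt (2 * sqrt (exp (real CARD('d) * C\<^sup>2) * (2 * C * (real CARD('d) * (16 * C * x * sqrt (real CARD('d))))) / 8)))" for x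
  \<comment> \<open>Infimum over \<epsilon>, lower limit over the mesh: the pathwise comparison
    holds only beyond a threshold that depends on \<omega>, \<open>u\<close> and \<epsilon>, and a
    lower limit ignores it.\<close>
  define Y where "Y \<omega> = (INF m. liminf (\<lambda>l. ennreal (D m l \<omega>)))" for \<omega>
  note [measurable] = D_meas
  have Y_meas: "Y \<in> borel_measurable M"
    unfolding Y_def by measurable
  have Y_le: "(\<integral>\<^sup>+\<omega>. Y \<omega> \<partial>M) \<le> ennreal (sqrt (h (?e m)))" for m
  proof -
    have "(\<integral>\<^sup>+\<omega>. Y \<omega> \<partial>M) \<le> (\<integral>\<^sup>+\<omega>. liminf (\<lambda>l. ennreal (D m l \<omega>)) \<partial>M)"
      unfolding Y_def by (intro nn_integral_mono INF_lower) simp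
    also have "\<dots> \<le> liminf (\<lambda>l. \<integral>\<^sup>+\<omega>. ennreal (D m l \<omega>) \<partial>M)"
      by (rule nn_integral_liminf) measurable
    also have "\<dots> \<le> liminf (\<lambda>l. ennreal (sqrt (scheme_gap (real CARD('d)) C (?n l) (?e m))))"
      by (intro Liminf_mono always_eventually allI D_nn)
    also have "\<dots> = ennreal (sqrt (h (?e m)))"
      unfolding h_def
      by (intro lim_imp_Liminf tendsto_ennrealI tendsto_real_sqrt scheme_gap_tendsto q) simp
    finally show ?thesis .
  qed
  \<comment> \<open>The limiting gap \<open>h\<close> is continuous and vanishes at \<epsilon> =
    0.\<close>
  have "(\<lambda>m. ennreal (sqrt (h (?e m)))) \<longlonglongrightarrow> ennreal (sqrt (h 0))"
    unfolding h_def by (intro tendsto_ennrealI tendsto_intros LIMSEQ_inverse_real_of_nat) simp_all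
  then have "(\<integral>\<^sup>+\<omega>. Y \<omega> \<partial>M) \<le> ennreal (sqrt (h 0))"
    by (rule LIMSEQ_le_const) (use Y_le in blast)
  then have "(\<integral>\<^sup>+\<omega>. Y \<omega> \<partial>M) = 0" by (simp add: h_def)
  then have "AE \<omega> in M. Y \<omega> = 0"
    using nn_integral_0_iff_AE[OF Y_meas] by simp
  then show ?thesis
  proof (rule AE_mp, intro AE_I2 impI allI)
    fix \<omega> u assume \<omega>: "\<omega> \<in> space M" and Y0: "Y \<omega> = 0" and u: "is_solution (\<lambda>s t. W s t \<omega>) u"
    let ?u = "u (real a / real q) (real c / real q) $ i"
    have "ennreal (g (?w \<omega> + ?u) - g (?w \<omega>)) \<le> liminf (\<lambda>l. ennreal (D m l \<omega>))" for m
    proof (rule Liminf_bounded)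
      have "?e m > 0" by simp
      from solution_le_scheme[OF brownian_sheetD(4)[OF W \<omega>] u this] obtain n0 where
        n0: "\<forall>n\<ge>n0. \<forall>X.
          (\<forall>j\<le>n. \<forall>k\<le>n. \<forall>i. X j k $ i = W (real j / real n) (real k / real n) \<omega> $ i + 1 / (real n)\<^sup>2 *
            (\<Sum>j'<j. \<Sum>k'<k. cell_mean n j' k' (X j' k' + vec (?e m)) $ i
               - cell_mean n j' k' (W (real j' / real n) (real k' / real n) \<omega> + vec (- ?e m)) $ i)) \<longrightarrow>
          (\<forall>j\<le>n. \<forall>k\<le>n. \<forall>i. W (real j / real n) (real k / real n) \<omega> $ i + u (real j / real n) (real k / real n) $ i \<le> X j k $ i)"
        by (elim exE conjE)
      show "\<forall>\<^sub>F l in sequentially. ennreal (g (?w \<omega> + ?u) - g (?w \<omega>)) \<le> ennreal (D m l \<omega>)"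
        using eventually_ge_at_top[of n0]
      proof eventually_elim
        case (elim l)
        have "l \<le> ?n l" using q by (cases q) auto
        then have "n0 \<le> ?n l" using elim by simp
        then have "W (real (?j l) / real (?n l)) (real (?k l) / real (?n l)) \<omega> $ i
            + u (real (?j l) / real (?n l)) (real (?k l) / real (?n l)) $ i \<le> X m l \<omega> (?j l) (?k l) $ i"
          by (rule n0[rule_format]) (rule dominating_process_eq[OF X _ _ \<omega>] jk | assumption)+
        then have "?w \<omega> + ?u \<le> X m l \<omega> (?j l) (?k l) $ i"
          unfolding frac .
        then have "g (?w \<omega> + ?u) \<le> g (X m l \<omega> (?j l) (?k l) $ i)" by (rule monoD[OF g(1)])
        then show ?case unfolding D_def by (intro ennreal_leI) simp
      qed
    qed
    then have "ennreal (g (?w \<omega> + ?u) - g (?w \<omega>)) \<le> Y \<omega>"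
      unfolding Y_def by (intro INF_greatest)
    then have "g (?w \<omega> + ?u) \<le> g (?w \<omega>)"
      using Y0 by (simp add: ennreal_eq_0_iff)
    then have "arctan (?w \<omega> + ?u) \<le> arctan (?w \<omega>)"
      unfolding g_def by (simp add: divide_le_cancel)
    then show "?u \<le> 0" by (simp add: arctan_le_iff)
  qed
qed

text \<open>Points with a common rational denominator are countable and dense in the square, so one
  null set is enough and continuity of \<open>u\<close> does the rest.\<close>

lemma AE_solution_nonpos:
  fixes W :: "real \<Rightarrow> real \<Rightarrow> 'a \<Rightarrow> real^'d"
  assumes W: "brownian_sheet M F W"
  shows "AE \<omega> in M. \<forall>u. is_solution (\<lambda>s t. W s t \<omega>) u \<longrightarrow> (\<forall>s\<in>{0..1}. \<forall>t\<in>{0..1}. \<forall>i. u s t $ i \<le> 0)"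
proof -
  have "AE \<omega> in M. \<forall>q a c i. q > 0 \<longrightarrow> a \<le> q \<longrightarrow> c \<le> q \<longrightarrow>
      (\<forall>u. is_solution (\<lambda>s t. W s t \<omega>) u \<longrightarrow> u (real a / real q) (real c / real q) $ i \<le> 0)"
    unfolding AE_all_countable
  proof (intro allI)
    fix q a c i
    show "AE \<omega> in M. q > 0 \<longrightarrow> a \<le> q \<longrightarrow> c \<le> q \<longrightarrow>
      (\<forall>u. is_solution (\<lambda>s t. W s t \<omega>) u \<longrightarrow> u (real a / real q) (real c / real q) $ i \<le> 0)"
      using AE_solution_nonpos_rational[OF W, of q a c i]
      by (cases "q > 0 \<and> a \<le> q \<and> c \<le> q") auto
  qed
  then show ?thesis
  proof (rule AE_mp, intro AE_I2 impI allI ballI)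
    fix \<omega> u s t i
    assume *: "\<forall>q a c i. q > 0 \<longrightarrow> a \<le> q \<longrightarrow> c \<le> q \<longrightarrow>
      (\<forall>u. is_solution (\<lambda>s t. W s t \<omega>) u \<longrightarrow> u (real a / real q) (real c / real q) $ i \<le> 0)"
      and u: "is_solution (\<lambda>s t. W s t \<omega>) u" and st: "s \<in> {0..1::real}" "t \<in> {0..1::real}"
    \<comment> \<open>Rounding down to denominator \<open>Suc l\<close> keeps the points in [0, 1]
      and gives both coordinates the same denominator.\<close>
    define f where "f x l = real (nat \<lfloor>x * real (Suc l)\<rfloor>) / real (Suc l)" for x :: real and l
    have nat_le: "nat \<lfloor>x * real (Suc l)\<rfloor> \<le> Suc l" if "x \<in> {0..1}" for x l
    proof -
      have "x * real (Suc l) \<le> real (Suc l)" using that by (intro mult_left_le_one_le) auto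
      then show ?thesis by linarith
    qed
    have f01: "f x l \<in> {0..1}" if "x \<in> {0..1}" for x l
      unfolding f_def by (rule grid_point[OF _ nat_le[OF that]]) simp
    have lim: "f x \<longlonglongrightarrow> x" if x: "x \<in> {0..1}" for x
    proof (rule real_tendsto_sandwich)
      have "x - inverse (real (Suc l)) \<le> f x l \<and> f x l \<le> x" for l
      proof -
        have "0 \<le> x * real (Suc l)" using x by simp
        then have le: "x * real (Suc l) - 1 \<le> real (nat \<lfloor>x * real (Suc l)\<rfloor>)" "real (nat \<lfloor>x * real (Suc l)\<rfloor>) \<le> x * real (Suc l)"
          by linarith+
        have "x - inverse (real (Suc l)) = (x * real (Suc l) - 1) / real (Suc l)"
          by (simp add: diff_divide_distrib inverse_eq_divide del: of_nat_Suc)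
        moreover have "x = x * real (Suc l) / real (Suc l)"
          by (simp del: of_nat_Suc)
        ultimately show ?thesis
          unfolding f_def using divide_right_mono[OF le(1), of "real (Suc l)"] divide_right_mono[OF le(2), of "real (Suc l)"]
          by simp
      qed
      then show "\<forall>\<^sub>F l in sequentially. x - inverse (real (Suc l)) \<le> f x l" "\<forall>\<^sub>F l in sequentially. f x l \<le> x"
        by auto
      show "(\<lambda>l. x - inverse (real (Suc l))) \<longlonglongrightarrow> x"
        using tendsto_diff[OF tendsto_const LIMSEQ_inverse_real_of_nat, of x] by simp
    qed simp
    have "(\<lambda>l. case (f s l, f t l) of (s, t) \<Rightarrow> u s t) \<longlonglongrightarrow> (case (s, t) of (s, t) \<Rightarrow> u s t)"
    proof (rule continuous_on_tendsto_compose[of "{0..1} \<times> {0..1}" "\<lambda>(s, t). u s t" "\<lambda>l. (f s l, f t l)" "(s, t)"])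
      show "continuous_on ({0..1} \<times> {0..1}) (\<lambda>(s, t). u s t)" using u unfolding is_solution_def by (rule conjunct1)
      show "(\<lambda>l. (f s l, f t l)) \<longlonglongrightarrow> (s, t)" using lim st by (intro tendsto_Pair)
      show "(s, t) \<in> {0..1} \<times> {0..1}" using st by simp
      show "\<forall>\<^sub>F l in sequentially. (f s l, f t l) \<in> {0..1} \<times> {0..1}"
        using f01[OF st(1)] f01[OF st(2)] by (intro always_eventually) auto
    qed
    from tendsto_vec_nth[OF this, of i]
    have "(\<lambda>l. u (f s l) (f t l) $ i) \<longlonglongrightarrow> u s t $ i"
      by (simp only: prod.case)
    moreover have "u (f s l) (f t l) $ i \<le> 0" for l
      unfolding f_def by (rule *[rule_format, OF _ nat_le[OF st(1)] nat_le[OF st(2)] u]) simp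
    ultimately show "u s t $ i \<le> 0"
      by (intro LIMSEQ_le_const2[of _ _ 0]) auto
  qed
qed

end

theorem mainTheorem4:
  fixes M :: "'a measure"
    and F :: "real \<Rightarrow> real \<Rightarrow> 'a measure"
    and W :: "real \<Rightarrow> real \<Rightarrow> 'a \<Rightarrow> real^'d"
    and b :: "real \<Rightarrow> real \<Rightarrow> real^'d \<Rightarrow> real^'d"
  assumes W: "brownian_sheet M F W"
    and b_meas: "(\<lambda>(s, t, x). if s \<in> {0..1} \<and> t \<in> {0..1} then b s t x else 0)
                   \<in> borel_measurable borel"
    and b_bdd: "\<exists>C. \<forall>s\<in>{0..1}. \<forall>t\<in>{0..1}. \<forall>x. norm (b s t x) \<le> C"
    and b_mono: "\<forall>s\<in>{0..1}. \<forall>t\<in>{0..1}. \<forall>x y. (\<forall>i. x $ i \<le> y $ i) \<longrightarrow>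
                   (\<forall>i. b s t x $ i \<le> b s t y $ i)"
  shows "\<exists>\<Omega>1. \<Omega>1 \<in> sets M \<and> measure M \<Omega>1 = 1 \<and>
           (\<forall>\<omega>\<in>\<Omega>1. \<forall>u :: real \<Rightarrow> real \<Rightarrow> real^'d.
              (continuous_on ({0..1} \<times> {0..1}) (\<lambda>(s, t). u s t) \<and>
               (\<forall>r\<in>{0..1}. u 0 r = 0 \<and> u r 0 = 0) \<and>
               (\<forall>s\<in>{0..1}. \<forall>t\<in>{0..1}.
                  u s t = (LINT \<zeta>:{0..t}|lborel. LINT \<xi>:{0..s}|lborel.
                     b \<xi> \<zeta> (W \<xi> \<zeta> \<omega> + u \<xi> \<zeta>) - b \<xi> \<zeta> (W \<xi> \<zeta> \<omega>))))
              \<longleftrightarrow> (\<forall>s\<in>{0..1}. \<forall>t\<in>{0..1}. u s t = 0))"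
proof -
  \<comment> \<open>Extension by 0 off the square: the hypotheses on \<open>b\<close> concern the
    square, while the locale wants a field at all times.\<close>
  define b' where "b' s t x = (if s \<in> {0..1} \<and> t \<in> {0..1} then b s t x else 0)" for s t x
  obtain C where C: "\<And>s t x. s \<in> {0..1} \<Longrightarrow> t \<in> {0..1} \<Longrightarrow> norm (b s t x) \<le> C"
    using b_bdd by blast
  have "0 \<le> C" using order_trans[OF norm_ge_zero C[of 0 0 0]] by simp
  have field: "drift_field b' C"
  proof
    show "(\<lambda>(s, t, x). b' s t x) \<in> borel_measurable borel"
      unfolding b'_def by (rule b_meas)
    show "\<bar>b' s t x $ i\<bar> \<le> C" for s t x i
      using C[of s t x] component_le_norm_cart[of "b s t x" i] \<open>0 \<le> C\<close> unfolding b'_def by auto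
    show "b' s t x $ i \<le> b' s t y $ i" if "\<And>i. x $ i \<le> y $ i" for s t x y i
      using b_mono that unfolding b'_def by simp
  qed
  \<comment> \<open>Reflecting both space and value reverses the order twice, so this field is again
    nondecreasing, and \<open>- u\<close> solves its equation along \<open>- W\<close>.\<close>
  have field_dual: "drift_field (\<lambda>s t x. - b' s t (- x)) C"
  proof
    have "(\<lambda>q. (fst q, fst (snd q), - snd (snd q))) \<in> borel \<rightarrow>\<^sub>M (borel :: (real \<times> real \<times> (real^'d)) measure)"
      by (intro borel_measurable_continuous_onI continuous_intros)
    from borel_measurable_uminus[OF measurable_compose[OF this drift_field.b_meas[OF field]]]
    show "(\<lambda>(s, t, x). - b' s t (- x)) \<in> borel_measurable borel"
      by (simp add: case_prod_unfold)
    show "\<bar>(- b' s t (- x)) $ i\<bar> \<le> C" for s t x i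
      using drift_field.b_bound[OF field, of s t "- x" i] by simp
    show "(- b' s t (- x)) $ i \<le> (- b' s t (- y)) $ i" if "\<And>i. x $ i \<le> y $ i" for s t x y i
      using drift_field.b_mono[OF field, of "- y" "- x" s t i] that by simp
  qed
  define good where "good \<omega> \<longleftrightarrow>
      (\<forall>u. drift_field.is_solution b' (\<lambda>s t. W s t \<omega>) u \<longrightarrow>
         (\<forall>s\<in>{0..1}. \<forall>t\<in>{0..1}. \<forall>i. u s t $ i \<le> 0)) \<and>
      (\<forall>u. drift_field.is_solution (\<lambda>s t x. - b' s t (- x)) (\<lambda>s t. - W s t \<omega>) u \<longrightarrow>
         (\<forall>s\<in>{0..1}. \<forall>t\<in>{0..1}. \<forall>i. u s t $ i \<le> 0))" for \<omega>
  have "AE \<omega> in M. good \<omega>"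
    unfolding good_def
    using drift_field.AE_solution_nonpos[OF field W]
      drift_field.AE_solution_nonpos[OF field_dual brownian_sheet_uminus[OF W]]
    by (rule AE_conjI)
  \<comment> \<open>The set where \<open>good\<close> fails need not be an event, so a measurable
    null set covering it is removed instead.\<close>
  then obtain N where N: "N \<in> null_sets M" and "{\<omega> \<in> space M. \<not> good \<omega>} \<subseteq> N"
    by (auto simp: eventually_ae_filter)
  then have good: "good \<omega>" if "\<omega> \<in> space M - N" for \<omega> using that by auto
  interpret prob_space M by (rule brownian_sheetD(1)[OF W])
  \<comment> \<open>Only points of the square are integrated over, so \<open>b\<close> and its
    extension give the same equation.\<close>
  have b'_int: "(LINT \<zeta>:{0..t}|lborel. LINT \<xi>:{0..s}|lborel. b' \<xi> \<zeta> (f \<xi> \<zeta>) - b' \<xi> \<zeta> (g \<xi> \<zeta>)) =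
      (LINT \<zeta>:{0..t}|lborel. LINT \<xi>:{0..s}|lborel. b \<xi> \<zeta> (f \<xi> \<zeta>) - b \<xi> \<zeta> (g \<xi> \<zeta>))"
    if "s \<in> {0..1}" "t \<in> {0..1}" for s t f g
    using that by (intro set_lebesgue_integral_cong allI impI) (auto simp: b'_def)
  show ?thesis
  proof (intro exI[of _ "space M - N"] conjI ballI allI iffI)
    show "space M - N \<in> events" using N by auto
    show "prob (space M - N) = 1"
      using N prob_compl[of N] by (simp add: null_sets_def measure_def)
  next
    fix \<omega> u s t
    assume \<omega>: "\<omega> \<in> space M - N" and st: "s \<in> {0..1::real}" "t \<in> {0..1::real}"
      and u: "continuous_on ({0..1} \<times> {0..1}) (\<lambda>(s, t). u s t) \<and>
        (\<forall>r\<in>{0..1}. u 0 r = 0 \<and> u r 0 = 0) \<and>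
        (\<forall>s\<in>{0..1}. \<forall>t\<in>{0..1}. u s t = (LINT \<zeta>:{0..t}|lborel. LINT \<xi>:{0..s}|lborel.
           b \<xi> \<zeta> (W \<xi> \<zeta> \<omega> + u \<xi> \<zeta>) - b \<xi> \<zeta> (W \<xi> \<zeta> \<omega>)))"
    have eq: "u s t = (LINT \<zeta>:{0..t}|lborel. LINT \<xi>:{0..s}|lborel.
           b' \<xi> \<zeta> (W \<xi> \<zeta> \<omega> + u \<xi> \<zeta>) - b' \<xi> \<zeta> (W \<xi> \<zeta> \<omega>))"
      if "s \<in> {0..1}" "t \<in> {0..1}" for s t
      unfolding b'_int[OF that] using u that by blast
    have sol: "drift_field.is_solution b' (\<lambda>s t. W s t \<omega>) u"
      unfolding drift_field.is_solution_def[OF field] using u eq by blast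
    have "drift_field.is_solution (\<lambda>s t x. - b' s t (- x)) (\<lambda>s t. - W s t \<omega>) (\<lambda>s t. - u s t)"
      unfolding drift_field.is_solution_def[OF field_dual]
    proof (intro conjI ballI)
      show "continuous_on ({0..1} \<times> {0..1}) (\<lambda>(s, t). - u s t)"
        using continuous_on_minus[OF conjunct1[OF u]] by (simp add: case_prod_unfold)
      show "- u 0 r = 0" "- u r 0 = 0" if "r \<in> {0..1}" for r
        using bspec[OF conjunct1[OF conjunct2[OF u]] that] by simp_all
      show "- u s t = (LINT \<zeta>:{0..t}|lborel. LINT \<xi>:{0..s}|lborel.
          - b' \<xi> \<zeta> (- (- W \<xi> \<zeta> \<omega> + - u \<xi> \<zeta>)) - (- b' \<xi> \<zeta> (- (- W \<xi> \<zeta> \<omega>))))"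
        if "s \<in> {0..1}" "t \<in> {0..1}" for s t
      proof -
        have "(LINT \<zeta>:{0..t}|lborel. LINT \<xi>:{0..s}|lborel.
            - b' \<xi> \<zeta> (- (- W \<xi> \<zeta> \<omega> + - u \<xi> \<zeta>)) - (- b' \<xi> \<zeta> (- (- W \<xi> \<zeta> \<omega>))))
          = (LINT \<zeta>:{0..t}|lborel. LINT \<xi>:{0..s}|lborel.
            - (b' \<xi> \<zeta> (W \<xi> \<zeta> \<omega> + u \<xi> \<zeta>) - b' \<xi> \<zeta> (W \<xi> \<zeta> \<omega>)))"
          by (simp add: add.commute)
        also have "\<dots> = - (LINT \<zeta>:{0..t}|lborel. LINT \<xi>:{0..s}|lborel.
            b' \<xi> \<zeta> (W \<xi> \<zeta> \<omega> + u \<xi> \<zeta>) - b' \<xi> \<zeta> (W \<xi> \<zeta> \<omega>))"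
          unfolding set_lebesgue_integral_def scaleR_minus_right Bochner_Integration.integral_minus ..
        finally show ?thesis using eq[OF that] by simp
      qed
    qed
    with good[OF \<omega>, unfolded good_def] sol st have "u s t $ i \<le> 0" "(- u s t) $ i \<le> 0" for i
      by blast+
    then show "u s t = 0"
      by (simp add: vec_eq_iff order_antisym)
  next
    fix \<omega> and u :: "real \<Rightarrow> real \<Rightarrow> real^'d"
    assume u: "\<forall>s\<in>{0..1}. \<forall>t\<in>{0..1}. u s t = 0"
    \<comment> \<open>\<open>u\<close> is known to vanish on the square only, so it is replaced
      there by the zero function.\<close>
    have "continuous_on ({0..1} \<times> {0..1}) (\<lambda>(s, t). u s t) = continuous_on ({0..1} \<times> {0..1}) (\<lambda>_ :: real \<times> real. 0 :: real^'d)"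
      using u by (intro continuous_on_cong) auto
    then show "continuous_on ({0..1} \<times> {0..1}) (\<lambda>(s, t). u s t)" by simp
    show "u 0 r = 0" "u r 0 = 0" if "r \<in> {0..1}" for r using u that by simp_all
    show "u s t = (LINT \<zeta>:{0..t}|lborel. LINT \<xi>:{0..s}|lborel.
           b \<xi> \<zeta> (W \<xi> \<zeta> \<omega> + u \<xi> \<zeta>) - b \<xi> \<zeta> (W \<xi> \<zeta> \<omega>))" if st: "s \<in> {0..1}" "t \<in> {0..1}" for s t
    proof -
      have "(LINT \<zeta>:{0..t}|lborel. LINT \<xi>:{0..s}|lborel.
           b \<xi> \<zeta> (W \<xi> \<zeta> \<omega> + u \<xi> \<zeta>) - b \<xi> \<zeta> (W \<xi> \<zeta> \<omega>)) = (LINT \<zeta>:{0..t}|lborel. LINT \<xi>:{0..s}|lborel. 0 :: real^'d)"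
        using st u by (intro set_lebesgue_integral_cong allI impI) auto
      then show ?thesis using u st by (simp add: set_lebesgue_integral_def)
    qed
  qed
qed

end
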